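(* Let $p$ be an odd prime and let $q$ be a prime power such that $p$ divides $q-1$ but $p^2$ does not divide $q-1$. If $1<n<p$, then $\mathrm{GL}(n,q)$ does not have a redundant Sylow $p$-subgroup, and $\mathrm{GL}(p,q)$ has a redundant Sylow $p$-subgroup.
   Context: For a finite group $G$ and a prime $p$, $G_p$ denotes the set of $p$-elements of $G$ and $\mathrm{Syl}_p(G)$ the set of Sylow $p$-subgroups of $G$. $G$ is said to have a redundant Sylow $p$-subgroup if $G_p$ is contained in the union of the members of some proper subset of $\mathrm{Syl}_p(G)$. *)

theory Defs
  imports "HOL-Algebra.Algebra" "Jordan_Normal_Form.Matrix"
begin

definition GL :: "nat \<Rightarrow> ('a::field) mat monoid" where
  "GL n = \<lparr> partial_object.carrier = {A \<in> carrier_mat n n. invertible_mat A},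
            monoid.mult = (\<lambda>A B. A * B), monoid.one = 1\<^sub>m n \<rparr>"

definition p_elements :: "('g, 'b) monoid_scheme \<Rightarrow> nat \<Rightarrow> 'g set" where
  "p_elements G p = {x \<in> carrier G. \<exists>k. group.ord G x = p ^ k}"

definition Sylow_subgroups :: "('g, 'b) monoid_scheme \<Rightarrow> nat \<Rightarrow> 'g set set" where
  "Sylow_subgroups G p = {P. subgroup P G \<and> card P = p ^ multiplicity p (order G)}"

definition has_redundant_Sylow :: "('g, 'b) monoid_scheme \<Rightarrow> nat \<Rightarrow> bool" where
  "has_redundant_Sylow G p \<longleftrightarrow>
     (\<exists>S. S \<subset> Sylow_subgroups G p \<and> p_elements G p \<subseteq> \<Union>S)"

end

theory Submission
  imports Defs "HOL-Library.Cardinality" "HOL-Number_Theory.Residues"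
    "Jordan_Normal_Form.Determinant"
begin

text \<open>
  Since \<open>p\<close> exactly divides \<open>q - 1\<close>, the order formula for \<open>GL(n, q)\<close> shows that a Sylow
  \<open>p\<close>-subgroup is the group of diagonal matrices over the \<open>p\<close>-th roots of unity if \<open>n < p\<close>, and the
  extension \<open>P\<close> of that group by the cyclic permutation matrices if \<open>n = p\<close>.

  For \<open>n < p\<close> a diagonal matrix with distinct entries has only diagonal matrices in its
  centralizer; as all Sylow subgroups are abelian of exponent \<open>p\<close>, it lies in only one of them.

  For \<open>n = p\<close> every \<open>x\<close> in \<open>P\<close> lies in two Sylow subgroups. If \<open>x\<close> is diagonal with a repeated
  entry, it commutes with a transvection that does not normalize \<open>P\<close>. If \<open>x\<close> is not diagonal and
  \<open>x\<^sup>p \<noteq> 1\<close>, it commutes with \<open>1 + x\<close>, which does not normalize \<open>P\<close>. Otherwise the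
  eigenvalues of \<open>x\<close> are all the \<open>p\<close>-th roots of unity, so \<open>x\<close> is conjugate both to a diagonal
  matrix and to the cyclic permutation matrix; these have different centralizers in \<open>P\<close>.
\<close>

section \<open>Sylow subgroups up to conjugation\<close>

definition (in monoid) conj_set :: "'a \<Rightarrow> 'a set \<Rightarrow> 'a set"
  where "conj_set g P = (\<lambda>x. g \<otimes> x \<otimes> inv g) ` P"

lemma (in group) inj_on_conj:
  assumes "g \<in> carrier G" shows "inj_on (\<lambda>x. g \<otimes> x \<otimes> inv g) (carrier G)"
  using assms by (auto intro!: inj_onI)

lemma (in group) subgroup_conj_set:
  assumes "subgroup P G" "g \<in> carrier G" shows "subgroup (conj_set g P) G"
proof -
  interpret P: subgroup P G by fact
  have "conj_set g P = g <# P #> inv g"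
    by (auto simp: conj_set_def l_coset_def r_coset_def)
  then show ?thesis
    using subgroup_conjugation_is_surj2[OF assms(2,1)] by simp
qed

lemma (in group) card_conj_set:
  assumes "P \<subseteq> carrier G" "g \<in> carrier G" shows "card (conj_set g P) = card P"
  unfolding conj_set_def using inj_on_conj[OF assms(2)] assms(1)
  by (intro card_image) (rule inj_on_subset)

text \<open>This action yields \<open>p_subgroup_in_conj_Sylow\<close>: a left coset
  \<open>a <# P\<close> fixed by all of \<open>H\<close> forces \<open>H\<close> into the conjugate
  of \<open>P\<close> by \<open>a\<close>. The maps are restricted because members of
  \<open>BijGroup\<close> are extensional.\<close>

lemma (in group) left_mult_action:
  assumes H: "subgroup H G" and P: "subgroup P G"
  shows "group_action (G\<lparr>carrier := H\<rparr>) (lcosets P) (\<lambda>h. restrict (\<lambda>C. h <# C) (lcosets P))"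
proof -
  interpret H: subgroup H G by fact
  interpret P: subgroup P G by fact
  have sub: "C \<subseteq> carrier G" if "C \<in> lcosets P" for C
    using that P.subset by (auto simp: LCOSETS_def l_coset_def)
  have cl: "h <# C \<in> lcosets P" if "C \<in> lcosets P" "h \<in> carrier G" for h C
    using that P.subset by (auto simp: LCOSETS_def lcos_m_assoc)
  have bij: "(restrict (\<lambda>C. h <# C) (lcosets P)) \<in> Bij (lcosets P)" if "h \<in> carrier G" for h
    unfolding Bij_def
  proof (intro IntI CollectI bij_betw_byWitness[where f' = "\<lambda>C. inv h <# C"])
    show "\<forall>C\<in>lcosets P. inv h <# (restrict (\<lambda>C. h <# C) (lcosets P)) C = C"
      using that sub by (auto simp: lcos_m_assoc lcos_mult_one)
    show "\<forall>C\<in>lcosets P. (restrict (\<lambda>C. h <# C) (lcosets P)) (inv h <# C) = C"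
      using that sub cl by (auto simp: lcos_m_assoc lcos_mult_one)
  qed (use that cl in auto)
  show ?thesis
  proof (intro group_action.intro group_hom.intro group_hom_axioms.intro homI)
    show "group (G\<lparr>carrier := H\<rparr>)" by (rule subgroup_imp_group[OF H])
    show "group (BijGroup (lcosets P))" by (rule group_BijGroup)
    fix h k assume "h \<in> carrier (G\<lparr>carrier := H\<rparr>)" "k \<in> carrier (G\<lparr>carrier := H\<rparr>)"
    then have hk: "h \<in> carrier G" "k \<in> carrier G" by auto
    show "restrict (\<lambda>C. (h \<otimes>\<^bsub>G\<lparr>carrier := H\<rparr>\<^esub> k) <# C) (lcosets P) =
      (restrict (\<lambda>C. h <# C) (lcosets P)) \<otimes>\<^bsub>BijGroup (lcosets P)\<^esub> (restrict (\<lambda>C. k <# C) (lcosets P))"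
      using hk bij sub cl by (auto simp: BijGroup_def compose_def lcos_m_assoc intro!: restrict_ext)
  qed (use bij in \<open>auto simp: BijGroup_def\<close>)
qed

text \<open>Let \<open>H\<close> act on the left cosets of \<open>P\<close>. Orbit sizes divide
  \<open>p ^ k\<close> and the number of cosets is prime to \<open>p\<close>, so some orbit is a
  single coset \<open>a <# P\<close>; fixing it puts \<open>H\<close> into the conjugate of
  \<open>P\<close> by \<open>a\<close>.\<close>

theorem (in group) p_subgroup_in_conj_Sylow:
  assumes fin: "finite (carrier G)" and p: "Factorial_Ring.prime p"
    and P: "P \<in> Sylow_subgroups G p"
    and H: "subgroup H G" and cH: "card H = p ^ k"
  shows "\<exists>g\<in>carrier G. H \<subseteq> conj_set g P"
proof -
  have sP: "subgroup P G" and cP: "card P = p ^ multiplicity p (Coset.order G)"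
    using P by (auto simp: Sylow_subgroups_def)
  interpret P: subgroup P G by fact
  interpret H: subgroup H G by fact
  let ?E = "lcosets P" and ?\<phi> = "\<lambda>h. restrict (\<lambda>C. h <# C) (lcosets P)"
  interpret A: group_action "G\<lparr>carrier := H\<rparr>" ?E ?\<phi> by (rule left_mult_action[OF H sP])
  have finE: "finite ?E" using fin by (simp add: LCOSETS_def)
  have "Coset.order G > 0" using fin by (simp add: order_gt_0_iff_finite)
  \<comment> \<open>Otherwise Lagrange would give one more factor \<open>p\<close> in the group
    order than its multiplicity allows.\<close>
  have np: "\<not> p dvd card ?E"
  proof
    assume "p dvd card ?E"
    then have "p * card P dvd card ?E * card P" by (rule mult_dvd_mono) simp
    then have "p ^ Suc (multiplicity p (Coset.order G)) dvd Coset.order G"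
      using l_lagrange[OF fin sP] cP by (metis power_Suc)
    then show False
      using power_dvd_iff_le_multiplicity[of "Coset.order G" p "Suc (multiplicity p (Coset.order G))"]
        \<open>Coset.order G > 0\<close> p by (simp add: prime_nat_iff)
  qed
  have "card ?E = (\<Sum>B\<in>orbits (G\<lparr>carrier := H\<rparr>) ?E ?\<phi>. card B)"
    using A.disjoint_sum[OF finE, of "\<lambda>_. 1::nat"] by simp
  then obtain C where C: "C \<in> ?E" "\<not> p dvd card (orbit (G\<lparr>carrier := H\<rparr>) ?\<phi> C)"
    using np dvd_sum[of "orbits (G\<lparr>carrier := H\<rparr>) ?E ?\<phi>" p card] unfolding orbits_def
    by (auto split: if_splits)
  have "card (orbit (G\<lparr>carrier := H\<rparr>) ?\<phi> C) dvd p ^ k"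
    using A.orbit_stabilizer_theorem[OF C(1)] cH by (simp add: Coset.order_def) (metis dvd_triv_left)
  then obtain j where "card (orbit (G\<lparr>carrier := H\<rparr>) ?\<phi> C) = p ^ j"
    using p divides_primepow_nat by blast
  with C(2) have "card (orbit (G\<lparr>carrier := H\<rparr>) ?\<phi> C) = 1" by (cases j) auto
  then have orb: "orbit (G\<lparr>carrier := H\<rparr>) ?\<phi> C = {C}"
    using A.orbit_refl[OF C(1)] by (auto simp: card_1_singleton_iff)
  obtain a where a: "a \<in> carrier G" "C = a <# P" using C(1) by (auto simp: LCOSETS_def)
  have "h \<in> conj_set a P" if h: "h \<in> H" for h
  proof -
    have hG: "h \<in> carrier G" using h by auto
    have "h <# C \<in> orbit (G\<lparr>carrier := H\<rparr>) ?\<phi> C"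
      using h C(1) by (force simp: orbit_def)
    then have "h <# C = C" using orb by simp
    then have "(h \<otimes> a) <# P = a <# P" using a hG P.subset by (simp add: lcos_m_assoc)
    moreover have "h \<otimes> a \<in> (h \<otimes> a) <# P" using P.one_closed a hG by (force simp: l_coset_def)
    ultimately obtain y where y: "y \<in> P" "h \<otimes> a = a \<otimes> y" by (auto simp: l_coset_def)
    then have "h = a \<otimes> y \<otimes> inv a" using a hG by (metis inv_solve_right m_closed P.mem_carrier)
    then show ?thesis using y by (auto simp: conj_set_def)
  qed
  then show ?thesis using a by auto
qed

lemma (in group) conj_set_Sylow:
  assumes "P \<in> Sylow_subgroups G p" "g \<in> carrier G"
  shows "conj_set g P \<in> Sylow_subgroups G p"
  using assms card_conj_set[of P g] subgroup_conj_set[of P g]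
  by (auto simp: Sylow_subgroups_def subgroup.subset)

text \<open>The inclusion from \<open>p_subgroup_in_conj_Sylow\<close> is between finite sets of
  equal size.\<close>

lemma (in group) Sylow_subgroups_conj:
  assumes fin: "finite (carrier G)" and p: "Factorial_Ring.prime p"
    and P: "P \<in> Sylow_subgroups G p" and Q: "Q \<in> Sylow_subgroups G p"
  obtains g where "g \<in> carrier G" "Q = conj_set g P"
proof -
  obtain g where g: "g \<in> carrier G" "Q \<subseteq> conj_set g P"
    using p_subgroup_in_conj_Sylow[OF fin p P, of Q] Q by (auto simp: Sylow_subgroups_def)
  have "conj_set g P \<in> Sylow_subgroups G p" by (rule conj_set_Sylow[OF P g(1)])
  then have "card (conj_set g P) = card Q" "conj_set g P \<subseteq> carrier G"
    using Q by (auto simp: Sylow_subgroups_def subgroup.subset)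
  then have "Q = conj_set g P" using g fin by (metis card_subset_eq finite_subset)
  then show ?thesis using g that by blast
qed

lemma (in group) Sylow_subset_p_elements:
  assumes p: "Factorial_Ring.prime p" and P: "P \<in> Sylow_subgroups G p"
  shows "P \<subseteq> p_elements G p"
proof
  fix x assume x: "x \<in> P"
  have sP: "subgroup P G" and cP: "card P = p ^ multiplicity p (Coset.order G)"
    using P by (auto simp: Sylow_subgroups_def)
  interpret P: group "G\<lparr>carrier := P\<rparr>" by (rule subgroup_imp_group[OF sP])
  have "x [^] card P = \<one>"
    using P.pow_order_eq_1[of x] x by (simp add: Coset.order_def nat_pow_consistent[symmetric])
  then have "ord x dvd p ^ multiplicity p (Coset.order G)"
    using x sP cP by (simp add: pow_eq_id subgroup.mem_carrier)
  then show "x \<in> p_elements G p"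
    using x sP p divides_primepow_nat by (auto simp: p_elements_def subgroup.mem_carrier)
qed

lemma (in group) conj_mult:
  assumes "g \<in> carrier G" "x \<in> carrier G" "y \<in> carrier G"
  shows "(g \<otimes> x \<otimes> inv g) \<otimes> (g \<otimes> y \<otimes> inv g) = g \<otimes> (x \<otimes> y) \<otimes> inv g"
proof -
  have "inv g \<otimes> (g \<otimes> (y \<otimes> inv g)) = y \<otimes> inv g" using assms by (simp add: m_assoc[symmetric])
  then show ?thesis using assms by (simp add: m_assoc)
qed

lemma (in group) conj_inv_conj:
  assumes "g \<in> carrier G" "x \<in> carrier G"
  shows "inv g \<otimes> (g \<otimes> x \<otimes> inv g) \<otimes> g = x"
proof -
  have "inv g \<otimes> (g \<otimes> x \<otimes> inv g) \<otimes> g = inv g \<otimes> (g \<otimes> x)" using assms by (simp add: m_assoc)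
  then show ?thesis using assms by (simp add: m_assoc[symmetric])
qed

lemma (in group) conj_nat_pow:
  assumes "g \<in> carrier G" "x \<in> carrier G"
  shows "(g \<otimes> x \<otimes> inv g) [^] (k::nat) = g \<otimes> x [^] k \<otimes> inv g"
  using assms by (induction k) (simp_all add: conj_mult)

text \<open>A point with this property stays covered after the removal of any single Sylow
  subgroup.\<close>

definition in_two_Sylows :: "('g, 'b) monoid_scheme \<Rightarrow> nat \<Rightarrow> 'g \<Rightarrow> bool" where
  "in_two_Sylows G p x \<longleftrightarrow>
     (\<exists>Q\<in>Sylow_subgroups G p. \<exists>R\<in>Sylow_subgroups G p. Q \<noteq> R \<and> x \<in> Q \<and> x \<in> R)"

lemma (in group) inj_on_conj_set:
  assumes "g \<in> carrier G" shows "inj_on (conj_set g) (Pow (carrier G))"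
  unfolding conj_set_def using inj_on_image_Pow[OF inj_on_conj[OF assms]] .

lemma (in group) in_two_Sylows_conj:
  assumes "in_two_Sylows G p x" "g \<in> carrier G"
  shows "in_two_Sylows G p (g \<otimes> x \<otimes> inv g)"
proof -
  obtain Q R where QR: "Q \<in> Sylow_subgroups G p" "R \<in> Sylow_subgroups G p" "Q \<noteq> R" "x \<in> Q" "x \<in> R"
    using assms(1) by (auto simp: in_two_Sylows_def)
  then have "Q \<in> Pow (carrier G)" "R \<in> Pow (carrier G)"
    by (auto simp: Sylow_subgroups_def dest: subgroup.mem_carrier)
  then have "conj_set g Q \<noteq> conj_set g R"
    using inj_on_conj_set[OF assms(2)] \<open>Q \<noteq> R\<close> by (auto dest: inj_onD)
  moreover have "g \<otimes> x \<otimes> inv g \<in> conj_set g Q" "g \<otimes> x \<otimes> inv g \<in> conj_set g R"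
    using QR by (auto simp: conj_set_def)
  ultimately show ?thesis
    using QR conj_set_Sylow assms(2) unfolding in_two_Sylows_def by blast
qed

text \<open>The Sylow subgroups other than \<open>P\<close> still cover: a \<open>p\<close>-element
  generates a cyclic \<open>p\<close>-subgroup, so it is conjugate to an element of
  \<open>P\<close>; hence it too lies in two Sylow subgroups, one of which is not
  \<open>P\<close>.\<close>

lemma (in group) has_redundant_SylowI:
  assumes fin: "finite (carrier G)" and p: "Factorial_Ring.prime p"
    and P: "P \<in> Sylow_subgroups G p" and two: "\<And>x. x \<in> P \<Longrightarrow> in_two_Sylows G p x"
  shows "has_redundant_Sylow G p"
  unfolding has_redundant_Sylow_def
proof (intro exI conjI subsetI)
  show "Sylow_subgroups G p - {P} \<subset> Sylow_subgroups G p" using P by auto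
  fix z assume "z \<in> p_elements G p"
  then obtain k where z: "z \<in> carrier G" "ord z = p ^ k" by (auto simp: p_elements_def)
  have "card (generate G {z}) = p ^ k" using generate_pow_card[OF z(1)] z(2) by simp
  moreover have "subgroup (generate G {z}) G" using z(1) by (intro generate_is_subgroup) simp
  ultimately obtain g where g: "g \<in> carrier G" "generate G {z} \<subseteq> conj_set g P"
    using p_subgroup_in_conj_Sylow[OF fin p P] by meson
  have "z \<in> generate G {z}" by (rule generate.incl) simp
  then have "z \<in> conj_set g P" using g(2) by (rule subsetD[rotated])
  then obtain x where "x \<in> P" "z = g \<otimes> x \<otimes> inv g" by (auto simp: conj_set_def)
  then have "in_two_Sylows G p z" using in_two_Sylows_conj two g by blast
  then show "z \<in> \<Union> (Sylow_subgroups G p - {P})" by (auto simp: in_two_Sylows_def)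
qed

text \<open>The second Sylow subgroup is the conjugate of \<open>P\<close> by \<open>g\<close>. It
  contains \<open>x\<close> because \<open>g\<close> centralizes \<open>x\<close>, and it contains
  the conjugate of \<open>y\<close>, which lies outside \<open>P\<close>. The condition on
  \<open>y\<close> avoids inverses so that it can be checked on entries of matrix products.\<close>

lemma (in group) in_two_Sylows_if_commutes:
  assumes P: "P \<in> Sylow_subgroups G p" and x: "x \<in> P"
    and g: "g \<in> carrier G" "g \<otimes> x = x \<otimes> g"
    and y: "y \<in> P" "\<And>m. m \<in> P \<Longrightarrow> g \<otimes> y \<noteq> m \<otimes> g"
  shows "in_two_Sylows G p x"
proof -
  have PG: "P \<subseteq> carrier G" using P by (auto simp: Sylow_subgroups_def dest: subgroup.mem_carrier)
  have "x = g \<otimes> x \<otimes> inv g" using g x PG by (metis inv_solve_right subsetD m_closed)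
  then have "x \<in> conj_set g P" using x by (auto simp: conj_set_def)
  moreover have "g \<otimes> y \<otimes> inv g \<in> conj_set g P" using y by (auto simp: conj_set_def)
  moreover have "g \<otimes> y \<otimes> inv g \<notin> P"
  proof
    assume "g \<otimes> y \<otimes> inv g \<in> P"
    moreover have "g \<otimes> y = (g \<otimes> y \<otimes> inv g) \<otimes> g" using g y(1) PG by (auto simp: m_assoc)
    ultimately show False using y(2) by blast
  qed
  ultimately show ?thesis using P conj_set_Sylow[OF P g(1)] x unfolding in_two_Sylows_def by metis
qed

section \<open>The order of the general linear group\<close>

lemma carrier_GL: "A \<in> carrier (GL n) \<longleftrightarrow> A \<in> carrier_mat n n \<and> invertible_mat A"
  and mult_GL [simp]: "A \<otimes>\<^bsub>GL n\<^esub> B = A * B"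
  and one_GL [simp]: "\<one>\<^bsub>GL n\<^esub> = 1\<^sub>m n"
  by (auto simp: GL_def)

text \<open>\<open>invertible_mat\<close> leaves the dimensions of the inverse open; the two product
  equations force them to be \<open>n\<close>.\<close>

lemma mem_GL_iff_inverse:
  "A \<in> carrier (GL n) \<longleftrightarrow>
     A \<in> carrier_mat n n \<and> (\<exists>B\<in>carrier_mat n n. A * B = 1\<^sub>m n \<and> B * A = 1\<^sub>m n)"
proof -
  have "B \<in> carrier_mat n n" if "A \<in> carrier_mat n n" "A * B = 1\<^sub>m n" "B * A = 1\<^sub>m (dim_row B)" for B
  proof -
    have "dim_col B = n" using arg_cong[OF that(2), of dim_col] by simp
    moreover have "dim_row B = n" using arg_cong[OF that(3), of dim_col] that(1) by simp
    ultimately show ?thesis by auto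
  qed
  then show ?thesis
    by (auto simp: carrier_GL invertible_mat_def inverts_mat_def)
qed

text \<open>A left inverse makes the kernel trivial; conversely, a trivial kernel makes the
  determinant nonzero.\<close>

lemma mem_GL_iff_inj:
  fixes A :: "'a::field mat"
  shows "A \<in> carrier (GL n) \<longleftrightarrow>
     A \<in> carrier_mat n n \<and> (\<forall>v\<in>carrier_vec n. A *\<^sub>v v = 0\<^sub>v n \<longrightarrow> v = 0\<^sub>v n)"
proof (intro iffI conjI ballI impI)
  assume A: "A \<in> carrier (GL n)"
  then obtain B where B: "A \<in> carrier_mat n n" "B \<in> carrier_mat n n" "B * A = 1\<^sub>m n"
    by (auto simp: mem_GL_iff_inverse)
  show "A \<in> carrier_mat n n" by fact
  fix v assume v: "v \<in> carrier_vec n" "A *\<^sub>v v = 0\<^sub>v n"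
  have "v = B * A *\<^sub>v v" using v(1) B(3) by simp
  also have "\<dots> = B *\<^sub>v (A *\<^sub>v v)" using B v(1) by (intro assoc_mult_mat_vec)
  also have "\<dots> = 0\<^sub>v n" unfolding v(2) using B(2) by auto
  finally show "v = 0\<^sub>v n" .
next
  assume A: "A \<in> carrier_mat n n \<and> (\<forall>v\<in>carrier_vec n. A *\<^sub>v v = 0\<^sub>v n \<longrightarrow> v = 0\<^sub>v n)"
  then have "det A \<noteq> 0" using det_0_iff_vec_prod_zero_field[of A n] by auto
  then show "A \<in> carrier (GL n)"
    using det_non_zero_imp_unit[of A n "()"] A
    by (auto simp: Units_def ring_mat_def mem_GL_iff_inverse)
qed

lemma GL_carrier_mat [dest]: "A \<in> carrier (GL n) \<Longrightarrow> A \<in> carrier_mat n n"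
  by (simp add: carrier_GL)

lemma group_GL: "group (GL n :: 'a::field mat monoid)"
proof (rule groupI)
  fix A B :: "'a mat" assume "A \<in> carrier (GL n)" "B \<in> carrier (GL n)"
  then obtain A' B' where m: "A \<in> carrier_mat n n" "B \<in> carrier_mat n n"
      "A' \<in> carrier_mat n n" "B' \<in> carrier_mat n n"
    and *: "A * A' = 1\<^sub>m n" "A' * A = 1\<^sub>m n" "B * B' = 1\<^sub>m n" "B' * B = 1\<^sub>m n"
    by (auto simp: mem_GL_iff_inverse)
  have "(A * B) * (B' * A') = A * (B * B') * A'" "(B' * A') * (A * B) = B' * (A' * A) * B"
    using m by (simp_all add: assoc_mult_mat[of _ n n _ n _ n])
  then have "(A * B) * (B' * A') = 1\<^sub>m n" "(B' * A') * (A * B) = 1\<^sub>m n"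
    using m by (simp_all add: *)
  then show "A \<otimes>\<^bsub>GL n\<^esub> B \<in> carrier (GL n)"
    unfolding mem_GL_iff_inverse mult_GL using m by (intro conjI bexI[of _ "B' * A'"]) auto
next
  fix A B C :: "'a mat" assume "A \<in> carrier (GL n)" "B \<in> carrier (GL n)" "C \<in> carrier (GL n)"
  then show "A \<otimes>\<^bsub>GL n\<^esub> B \<otimes>\<^bsub>GL n\<^esub> C = A \<otimes>\<^bsub>GL n\<^esub> (B \<otimes>\<^bsub>GL n\<^esub> C)"
    by (auto simp: mem_GL_iff_inverse)
next
  fix A :: "'a mat" assume "A \<in> carrier (GL n)"
  then show "\<exists>B\<in>carrier (GL n). B \<otimes>\<^bsub>GL n\<^esub> A = \<one>\<^bsub>GL n\<^esub>"
    by (fastforce simp: mem_GL_iff_inverse)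
qed (auto simp: mem_GL_iff_inverse intro!: bexI[of _ "1\<^sub>m n"])

lemma pow_GL: "A [^]\<^bsub>GL n\<^esub> (k::nat) = A ^\<^sub>m k" if "A \<in> carrier_mat n n"
  using that by (induction k) (auto simp: nat_pow_def GL_def)

lemma card_carrier_vec: "card (carrier_vec n :: 'a::finite vec set) = CARD('a) ^ n"
  and finite_carrier_vec [simp]: "finite (carrier_vec n :: 'a::finite vec set)"
proof (induction n)
  case (Suc n)
  have eq: "carrier_vec (Suc n) = (\<lambda>(a, v). vCons a v) ` (UNIV \<times> carrier_vec n :: ('a \<times> 'a vec) set)"
  proof (intro equalityI subsetI)
    fix v :: "'a vec" assume "v \<in> carrier_vec (Suc n)"
    then show "v \<in> (\<lambda>(a, v). vCons a v) ` (UNIV \<times> carrier_vec n)"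
      by (cases v) auto
  qed auto
  have "inj_on (\<lambda>(a, v). vCons a v) (UNIV \<times> carrier_vec n :: ('a \<times> 'a vec) set)"
    by (auto intro!: inj_onI)
  then show "card (carrier_vec (Suc n) :: 'a vec set) = CARD('a) ^ Suc n"
    unfolding eq by (simp add: card_image card_cartesian_product Suc)
  show "finite (carrier_vec (Suc n) :: 'a vec set)" unfolding eq using Suc by auto
next
  case 0
  have "carrier_vec 0 = {vNil :: 'a vec}" by auto
  then show "card (carrier_vec 0 :: 'a vec set) = CARD('a) ^ 0"
    and "finite (carrier_vec 0 :: 'a vec set)" by simp_all
qed

lemma smult_vec_zero: "0 \<cdot>\<^sub>v v = 0\<^sub>v n" if "v \<in> carrier_vec n" for v :: "'a::field vec"
  using that by auto

section \<open>Counting linearly independent lists of vectors\<close>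

definition lin_combs :: "nat \<Rightarrow> 'a::field vec list \<Rightarrow> 'a vec set" where
  "lin_combs n vs = (\<lambda>a. mat_of_cols n vs *\<^sub>v a) ` carrier_vec (length vs)"

text \<open>Phrased as a trivial kernel, so that for \<open>n\<close> vectors it is the condition of
  \<open>mem_GL_iff_inj\<close> on the matrix with these columns.\<close>

definition lin_indep_list :: "nat \<Rightarrow> 'a::field vec list \<Rightarrow> bool" where
  "lin_indep_list n vs \<longleftrightarrow> set vs \<subseteq> carrier_vec n \<and>
     (\<forall>a\<in>carrier_vec (length vs). mat_of_cols n vs *\<^sub>v a = 0\<^sub>v n \<longrightarrow> a = 0\<^sub>v (length vs))"

lemma mat_of_cols_Cons_mult_vec:
  fixes v :: "'a::field vec"
  assumes "v \<in> carrier_vec n" "a \<in> carrier_vec (length vs)"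
  shows "mat_of_cols n (v # vs) *\<^sub>v vCons c a = c \<cdot>\<^sub>v v + mat_of_cols n vs *\<^sub>v a"
proof (rule eq_vecI)
  fix i assume "i < dim_vec (c \<cdot>\<^sub>v v + mat_of_cols n vs *\<^sub>v a)"
  then have i: "i < n" by simp
  have "row (mat_of_cols n (v # vs)) i = vCons (v $ i) (row (mat_of_cols n vs) i)"
    using i by (intro eq_vecI) (auto simp: mat_of_cols_def vec_index_vCons nth_Cons')
  then show "(mat_of_cols n (v # vs) *\<^sub>v vCons c a) $ i = (c \<cdot>\<^sub>v v + mat_of_cols n vs *\<^sub>v a) $ i"
    using i assms by (simp add: mult.commute)
qed (use assms in auto)

lemma card_lin_combs:
  fixes vs :: "'a::{finite,field} vec list"
  assumes "lin_indep_list n vs" shows "card (lin_combs n vs) = CARD('a) ^ length vs"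
proof -
  let ?M = "mat_of_cols n vs"
  have M: "?M \<in> carrier_mat n (length vs)" by simp
  have "inj_on (\<lambda>a. ?M *\<^sub>v a) (carrier_vec (length vs))"
  proof (rule inj_onI)
    fix a b assume ab: "a \<in> carrier_vec (length vs)" "b \<in> carrier_vec (length vs)"
      "?M *\<^sub>v a = ?M *\<^sub>v b"
    have "?M *\<^sub>v (a - b) = 0\<^sub>v n"
      using mult_minus_distrib_mat_vec[OF M ab(1,2)] ab(3) by auto
    then have "a - b = 0\<^sub>v (length vs)" using assms ab by (auto simp: lin_indep_list_def)
    then have d: "(a - b) $ i = 0" if "i < length vs" for i using that by simp
    show "a = b"
    proof (rule eq_vecI)
      fix i assume "i < dim_vec b"
      then show "a $ i = b $ i" using d[of i] ab by auto
    qed (use ab in auto)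
  qed
  then show ?thesis by (simp add: lin_combs_def card_image card_carrier_vec)
qed

text \<open>If \<open>v\<close> is in the span of \<open>vs\<close>, there is a relation with
  coefficient \<open>- 1\<close> at \<open>v\<close>. Conversely, a relation with nonzero
  coefficient at \<open>v\<close> can be solved for \<open>v\<close>.\<close>

lemma lin_indep_list_Cons:
  fixes v :: "'a::field vec"
  shows "lin_indep_list n (v # vs) \<longleftrightarrow> lin_indep_list n vs \<and> v \<in> carrier_vec n - lin_combs n vs"
proof (cases "v \<in> carrier_vec n \<and> set vs \<subseteq> carrier_vec n")
  case True
  then have v: "v \<in> carrier_vec n" by simp
  note eq = mat_of_cols_Cons_mult_vec[OF v]
  have M: "mat_of_cols n vs \<in> carrier_mat n (length vs)" by simp
  show ?thesis
  proof (intro iffI conjI)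
    assume ind: "lin_indep_list n (v # vs)"
    have *: "c = 0 \<and> a = 0\<^sub>v (length vs)"
      if "a \<in> carrier_vec (length vs)" "c \<cdot>\<^sub>v v + mat_of_cols n vs *\<^sub>v a = 0\<^sub>v n" for c a
    proof -
      have "vCons c a = 0\<^sub>v (Suc (length vs))"
        using ind that eq[OF that(1), of c] by (auto simp: lin_indep_list_def)
      then show ?thesis by (simp add: zero_vec_Suc)
    qed
    show "lin_indep_list n vs" unfolding lin_indep_list_def
    proof (intro conjI ballI impI)
      fix a assume "a \<in> carrier_vec (length vs)" "mat_of_cols n vs *\<^sub>v a = 0\<^sub>v n"
      then show "a = 0\<^sub>v (length vs)" using *[of a 0] v by (auto simp: smult_vec_zero)
    qed (use True in auto)
    have "v \<notin> lin_combs n vs"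
    proof
      assume "v \<in> lin_combs n vs"
      then obtain a where a: "a \<in> carrier_vec (length vs)" "v = mat_of_cols n vs *\<^sub>v a"
        by (auto simp: lin_combs_def)
      have "(- 1) \<cdot>\<^sub>v v + mat_of_cols n vs *\<^sub>v a = 0\<^sub>v n"
        unfolding a(2)[symmetric] using v by (intro eq_vecI) auto
      then show False using *[OF a(1)] by fastforce
    qed
    then show "v \<in> carrier_vec n - lin_combs n vs" using v by simp
  next
    assume H: "lin_indep_list n vs \<and> v \<in> carrier_vec n - lin_combs n vs"
    show "lin_indep_list n (v # vs)" unfolding lin_indep_list_def
    proof (intro conjI ballI impI)
      fix b assume b: "b \<in> carrier_vec (length (v # vs))" "mat_of_cols n (v # vs) *\<^sub>v b = 0\<^sub>v n"
      obtain c a where ca: "b = vCons c a" using b(1) by (cases b) auto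
      then have a: "a \<in> carrier_vec (length vs)" using b(1) by simp
      have z: "c \<cdot>\<^sub>v v + mat_of_cols n vs *\<^sub>v a = 0\<^sub>v n" using b(2) eq[OF a] ca by simp
      have zi: "c * v $ i + (mat_of_cols n vs *\<^sub>v a) $ i = 0" if "i < n" for i
        using arg_cong[OF z, of "\<lambda>w. w $ i"] that v by simp
      have c: "c = 0"
      proof (rule ccontr)
        assume c: "c \<noteq> 0"
        have "v = mat_of_cols n vs *\<^sub>v ((- inverse c) \<cdot>\<^sub>v a)"
        proof (rule eq_vecI)
          fix i assume "i < dim_vec (mat_of_cols n vs *\<^sub>v ((- inverse c) \<cdot>\<^sub>v a))"
          then have i: "i < n" by simp
          have "(mat_of_cols n vs *\<^sub>v ((- inverse c) \<cdot>\<^sub>v a)) $ i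
              = - inverse c * (mat_of_cols n vs *\<^sub>v a) $ i"
            using mult_mat_vec[OF M a, of "- inverse c"] i by simp
          also have "\<dots> = - inverse c * (- (c * v $ i))" using zi[OF i]
            by (metis add.commute add_eq_0_iff2)
          also have "\<dots> = v $ i" using c by simp
          finally show "v $ i = (mat_of_cols n vs *\<^sub>v ((- inverse c) \<cdot>\<^sub>v a)) $ i" by simp
        qed (use v in auto)
        then show False using H a by (auto simp: lin_combs_def)
      qed
      have "mat_of_cols n vs *\<^sub>v a = 0\<^sub>v n"
        using zi c by (intro eq_vecI) auto
      then have "a = 0\<^sub>v (length vs)" using H a by (auto simp: lin_indep_list_def)
      then show "b = 0\<^sub>v (length (v # vs))" using ca c by (simp add: zero_vec_Suc)
    qed (use True in auto)
  qed
qed (auto simp: lin_indep_list_def)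

text \<open>Vectors are chosen one after another, each outside the span of the earlier ones; the
  span of \<open>k\<close> independent vectors has \<open>CARD('a) ^ k\<close> elements. Finiteness
  is part of the induction because the step sums over all shorter lists.\<close>

lemma card_lin_indep_lists:
  "card {vs :: 'a::{finite,field} vec list. length vs = k \<and> lin_indep_list n vs}
     = (\<Prod>i<k. CARD('a) ^ n - CARD('a) ^ i)
   \<and> finite {vs :: 'a::{finite,field} vec list. length vs = k \<and> lin_indep_list n vs}"
proof (induction k)
  case 0
  have "lin_indep_list n ([] :: 'a vec list)" by (auto simp: lin_indep_list_def)
  then have "{vs :: 'a vec list. length vs = 0 \<and> lin_indep_list n vs} = {[]}" by auto
  then show ?case by simp
next
  case (Suc k)
  let ?L = "\<lambda>k. {vs :: 'a vec list. length vs = k \<and> lin_indep_list n vs}"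
  have eq: "?L (Suc k) = (\<lambda>(vs, v). v # vs) ` (SIGMA vs:?L k. carrier_vec n - lin_combs n vs)"
    by (force simp: length_Suc_conv lin_indep_list_Cons image_iff)
  have "inj_on (\<lambda>(vs, v). v # vs) (SIGMA vs:?L k. carrier_vec n - lin_combs n vs)"
    by (auto intro!: inj_onI)
  then have "card (?L (Suc k)) = card (SIGMA vs:?L k. carrier_vec n - lin_combs n vs)"
    unfolding eq by (rule card_image)
  also have "\<dots> = (\<Sum>vs\<in>?L k. card (carrier_vec n - lin_combs n vs))"
    using Suc by (intro card_SigmaI) auto
  also have "\<dots> = (\<Sum>vs\<in>?L k. CARD('a) ^ n - CARD('a) ^ k)"
  proof (rule sum.cong)
    fix vs assume vs: "vs \<in> ?L k"
    have "lin_combs n vs \<subseteq> carrier_vec n"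
      unfolding lin_combs_def by (auto intro: mult_mat_vec_carrier[OF mat_of_cols_carrier(1)])
    then have "card (carrier_vec n - lin_combs n vs) = card (carrier_vec n :: 'a vec set) - card (lin_combs n vs)"
      by (intro card_Diff_subset) (auto intro: finite_subset[OF _ finite_carrier_vec])
    then show "card (carrier_vec n - lin_combs n vs) = CARD('a) ^ n - CARD('a) ^ k"
      using vs by (simp add: card_lin_combs card_carrier_vec)
  qed simp
  also have "\<dots> = (\<Prod>i<Suc k. CARD('a) ^ n - CARD('a) ^ i)" using Suc by simp
  finally show ?case unfolding eq using Suc by auto
qed

text \<open>An invertible matrix amounts to the list of its \<open>n\<close> independent
  columns.\<close>

theorem order_GL:
  "Coset.order (GL n :: 'a::{finite,field} mat monoid) = (\<Prod>i<n. CARD('a) ^ n - CARD('a) ^ i)"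
  and finite_GL: "finite (carrier (GL n :: 'a mat monoid))"
proof -
  let ?L = "{vs :: 'a vec list. length vs = n \<and> lin_indep_list n vs}"
  have "bij_betw cols (carrier (GL n)) ?L"
  proof (rule bij_betw_byWitness[where f' = "mat_of_cols n"])
    show "\<forall>A\<in>carrier (GL n :: 'a mat monoid). mat_of_cols n (cols A) = A"
      by (auto dest!: GL_carrier_mat)
    show "\<forall>vs\<in>?L. cols (mat_of_cols n vs) = vs" by (auto simp: lin_indep_list_def)
    show "cols ` carrier (GL n :: 'a mat monoid) \<subseteq> ?L"
    proof (clarify, intro conjI)
      fix A :: "'a mat" assume "A \<in> carrier (GL n)"
      then have A: "A \<in> carrier_mat n n" "\<forall>v\<in>carrier_vec n. A *\<^sub>v v = 0\<^sub>v n \<longrightarrow> v = 0\<^sub>v n"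
        by (auto simp: mem_GL_iff_inj)
      have "mat_of_cols n (cols A) = A" using A(1) by (metis carrier_matD(1) mat_of_cols_cols)
      then show "lin_indep_list n (cols A)"
        using A cols_dim[of A] by (auto simp: lin_indep_list_def)
      show "length (cols A) = n" using A by simp
    qed
    show "mat_of_cols n ` ?L \<subseteq> carrier (GL n)"
      by (auto simp: lin_indep_list_def mem_GL_iff_inj)
  qed
  then show "Coset.order (GL n :: 'a mat monoid) = (\<Prod>i<n. CARD('a) ^ n - CARD('a) ^ i)"
    and "finite (carrier (GL n :: 'a mat monoid))"
    using card_lin_indep_lists[of n n, where 'a = 'a]
    by (auto simp: Coset.order_def bij_betw_same_card dest: bij_betw_finite)
qed

section \<open>Roots of unity in finite fields and multiplicities\<close>

text \<open>Multiplication by \<open>x\<close> permutes the nonzero elements, so their product is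
  unchanged while it gains a factor \<open>x\<close> for each of them.\<close>

lemma field_power_card_minus_1:
  fixes x :: "'a::{finite,field}"
  assumes "x \<noteq> 0" shows "x ^ (CARD('a) - 1) = 1"
proof -
  let ?U = "UNIV - {0 :: 'a}"
  have "bij_betw ((*) x) ?U ?U"
    by (rule bij_betw_byWitness[where f' = "\<lambda>y. y / x"]) (use assms in auto)
  then have "(\<Prod>y\<in>?U. x * y) = \<Prod>?U" using prod.reindex_bij_betw[of "(*) x" ?U ?U "\<lambda>y. y"] by simp
  moreover have "(\<Prod>y\<in>?U. x * y) = x ^ (CARD('a) - 1) * \<Prod>?U"
    by (simp add: prod.distrib card_Diff_singleton)
  moreover have "\<Prod>?U \<noteq> 0" by simp
  ultimately show ?thesis by simp
qed

lemma card_roots_of_unity_le: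
  assumes "m > 0" shows "card {x::'a::field. x ^ m = 1} \<le> m"
proof -
  let ?f = "Polynomial.monom 1 m - 1 :: 'a poly"
  have "poly.coeff ?f m = 1" using assms by simp
  then have "?f \<noteq> 0" by (metis coeff_0 zero_neq_one)
  moreover have "degree ?f \<le> m" by (intro degree_diff_le) (auto simp: degree_monom_le)
  ultimately show ?thesis
    using card_poly_roots_bound[of ?f] by (simp add: poly_monom)
qed

text \<open>With \<open>m\<close> the quotient of \<open>CARD('a) - 1\<close> by \<open>p\<close>,
  at most \<open>m\<close> elements satisfy \<open>x ^ m = 1\<close>. So some nonzero
  \<open>a\<close> has \<open>a ^ m \<noteq> 1\<close>, and \<open>a ^ m\<close> is the required
  root.\<close>

lemma ex_nontrivial_root_of_unity:
  assumes "p dvd CARD('a::{finite,field}) - 1" "Factorial_Ring.prime p"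
  shows "\<exists>w::'a. w ^ p = 1 \<and> w \<noteq> 1"
proof -
  obtain m where m: "CARD('a) - 1 = p * m" using assms(1) by (auto elim: dvdE)
  have two: "CARD('a) \<ge> 2" using card_mono[of UNIV "{0::'a, 1}"] by simp
  then have "m > 0" using m by (cases m) auto
  have "card {x::'a. x ^ m = 1} \<le> m" by (rule card_roots_of_unity_le) fact
  also have "m < card (UNIV - {0::'a})"
    using m \<open>m > 0\<close> prime_gt_1_nat[OF assms(2)] by (simp add: card_Diff_singleton)
  finally have "\<not> UNIV - {0::'a} \<subseteq> {x. x ^ m = 1}"
    by (metis card_mono finite leD)
  then obtain a :: 'a where a: "a \<noteq> 0" "a ^ m \<noteq> 1" by auto
  have "(a ^ m) ^ p = 1" using field_power_card_minus_1[OF a(1)] m by (simp add: power_mult[symmetric] mult.commute)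
  then show ?thesis using a by blast
qed


lemma coprime_powers_eq_1:
  fixes w :: "'a::monoid_mult"
  assumes "w ^ a = 1" "w ^ b = 1" "coprime a b" shows "w = 1"
proof (cases "a = 0")
  case False
  then obtain x y where "a * x = b * y + 1" using bezout_nat[of a b] assms(3) by auto
  then have "(w ^ a) ^ x = (w ^ b) ^ y * w" 
    by (simp add: power_mult[symmetric] power_add power_commutes)
  then show ?thesis using assms by simp
qed (use assms in auto)

lemma power_inj_root_of_unity:
  fixes w :: "'a::field"
  assumes p: "Factorial_Ring.prime p" and w: "w ^ p = 1" "w \<noteq> 1"
    and ij: "w ^ i = w ^ j" "i < p" "j < p"
  shows "i = j"
proof -
  have False if "i < j" "w ^ i = w ^ j" "j < p" for i j
  proof -
    have "w \<noteq> 0" using w prime_gt_0_nat[OF p] by (auto simp: zero_power)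
    have "w ^ i * w ^ (j - i) = w ^ i * 1" 
      using that by (metis le_add_diff_inverse less_imp_le mult_1_right power_add)
    then have "w ^ (j - i) = 1" using \<open>w \<noteq> 0\<close> by simp
    moreover have "coprime (j - i) p"
      using that p by (metis coprime_commute prime_imp_coprime_nat nat_dvd_not_less zero_less_diff less_imp_diff_less)
    ultimately show False using w(1) w(2) coprime_powers_eq_1 by blast
  qed
  then show ?thesis using ij by (metis nat_neq_iff)
qed

text \<open>The \<open>p\<close> powers of \<open>w\<close> are distinct, and there are at most
  \<open>p\<close> roots.\<close>

lemma roots_of_unity_eq:
  fixes w :: "'a::{finite,field}"
  assumes p: "Factorial_Ring.prime p" and w: "w ^ p = 1" "w \<noteq> 1"
  shows "{x. x ^ p = 1} = (\<lambda>i. w ^ i) ` {..<p}" and "card {x::'a. x ^ p = 1} = p"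
proof -
  have "inj_on (\<lambda>i. w ^ i) {..<p}" using power_inj_root_of_unity[OF p w] by (auto intro: inj_onI)
  then have c: "card ((\<lambda>i. w ^ i) ` {..<p}) = p" by (simp add: card_image)
  have s: "(\<lambda>i. w ^ i) ` {..<p} \<subseteq> {x. x ^ p = 1}"
    using w(1) by (auto simp: power_mult[symmetric] mult.commute[of _ p]) (simp add: power_mult)
  show eq: "{x. x ^ p = 1} = (\<lambda>i. w ^ i) ` {..<p}"
    using card_seteq[OF _ s] c card_roots_of_unity_le[where 'a = 'a, OF prime_gt_0_nat[OF p]] by simp
  show "card {x::'a. x ^ p = 1} = p" unfolding eq by (rule c)
qed

section \<open>Multiplicity of p in the order formula\<close>

lemma geometric_sum_nat: "(1 + a) ^ j = 1 + a * (\<Sum>i<j. (1 + a) ^ i)" for a :: nat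
  by (induction j) (auto simp: algebra_simps)

text \<open>\<open>q ^ j - 1\<close> is \<open>p * m\<close> times the geometric sum
  \<open>S\<close>. As \<open>q\<close> is 1 modulo \<open>p\<close>, \<open>S\<close> is congruent
  to \<open>j\<close>, which is prime to \<open>p\<close>.\<close>

lemma multiplicity_power_minus_1_less:
  fixes q :: nat
  assumes p: "Factorial_Ring.prime p" and q: "q = 1 + p * m" "\<not> p dvd m" and j: "0 < j" "j < p"
  shows "multiplicity p (q ^ j - 1) = 1"
proof -
  define S where "S = (\<Sum>i<j. q ^ i)"
  have "[S = (\<Sum>i<j. 1 ^ i)] (mod p)"
    unfolding S_def by (intro cong_sum cong_pow) (metis q(1) cong_add_lcancel_0_nat cong_0_iff dvd_triv_left)
  then have "[S = j] (mod p)" by simp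
  then have "\<not> p dvd S" using j by (metis cong_dvd_iff nat_dvd_not_less)
  then have nd: "\<not> p dvd m * S" using q(2) p by (simp add: prime_dvd_mult_iff)
  have "q ^ j = 1 + p * m * S" using geometric_sum_nat[of "p * m" j] unfolding S_def q(1) .
  then have "q ^ j - 1 = p * (m * S)" by simp
  then have "p ^ 1 dvd q ^ j - 1" "\<not> p ^ Suc 1 dvd q ^ j - 1"
    using nd prime_gt_0_nat[OF p] by auto
  then show ?thesis by (rule multiplicity_eqI)
qed

text \<open>Here the geometric sum contributes a second factor:
  \<open>S p = p * (1 + m * T)\<close>. There is no third one, because \<open>T\<close> is congruent
  to \<open>p * (p - 1) div 2\<close>, a multiple of \<open>p\<close> for odd
  \<open>p\<close>.\<close>

lemma multiplicity_power_minus_1_eq: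
  fixes q :: nat
  assumes p: "Factorial_Ring.prime p" and q: "q = 1 + p * m" "\<not> p dvd m" and odd: "odd p"
  shows "multiplicity p (q ^ p - 1) = 2"
proof -
  define S where "S = (\<lambda>j. \<Sum>i<j. q ^ i)"
  define T where "T = (\<Sum>j<p. S j)"
  have S: "[S j = j] (mod p)" for j
  proof -
    have "[S j = (\<Sum>i<j. 1 ^ i)] (mod p)"
      unfolding S_def by (intro cong_sum cong_pow) (metis q(1) cong_add_lcancel_0_nat cong_0_iff dvd_triv_left)
    then show ?thesis by simp
  qed
  have g: "q ^ j = 1 + p * m * S j" for j
    using geometric_sum_nat[of "p * m" j] unfolding S_def q(1) .
  \<comment> \<open>Each power of \<open>q\<close> inside the geometric sum is expanded by
    \<open>g\<close> once more.\<close>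
  have "S p = (\<Sum>j<p. 1 + p * m * S j)"
    by (subst g[symmetric]) (simp add: S_def)
  also have "\<dots> = p * (1 + m * T)" unfolding T_def
    by (subst sum.distrib) (simp add: sum_distrib_left algebra_simps)
  finally have Sp: "S p = p * (1 + m * T)" .
  have "[T = (\<Sum>j<p. j)] (mod p)" unfolding T_def by (rule cong_sum) (rule S)
  moreover have "p dvd (\<Sum>j<p. j)"
  proof -
    have "(\<Sum>j<p. j) = p * (p - 1) div 2"
      using Sum_Ico_nat[of 0 p] by (simp add: atLeast0LessThan)
    also have "\<dots> = p * ((p - 1) div 2)" using odd by (simp add: div_mult_swap)
    finally show ?thesis by simp
  qed
  ultimately have "p dvd T" by (simp add: cong_dvd_iff)
  then have "\<not> p dvd 1 + m * T" using p by (metis dvd_add_left_iff dvd_mult not_prime_unit)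
  then have nd: "\<not> p dvd m * (1 + m * T)" using q(2) p by (metis prime_dvd_mult_iff)
  have "q ^ p - 1 = p ^ 2 * (m * (1 + m * T))"
    unfolding g Sp by (simp add: power2_eq_square algebra_simps)
  moreover have "\<not> p ^ 2 * p dvd p ^ 2 * (m * (1 + m * T))"
    using nd prime_gt_0_nat[OF p] by (subst nat_mult_dvd_cancel1) auto
  ultimately have "p ^ 2 dvd q ^ p - 1" "\<not> p ^ Suc 2 dvd q ^ p - 1"
    unfolding power_Suc2 by (metis dvd_triv_left)+
  then show ?thesis by (rule multiplicity_eqI)
qed

text \<open>Splitting off \<open>q ^ i\<close>, which is prime to \<open>p\<close>, leaves
  \<open>q ^ (n - i) - 1\<close>. This contributes one factor \<open>p\<close>, or two when the
  exponent is \<open>p\<close>, that is, for \<open>i = 0\<close> and \<open>n = p\<close>.\<close>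

lemma multiplicity_prod_power_diff:
  fixes q :: nat
  assumes p: "Factorial_Ring.prime p" and q: "q = 1 + p * m" "\<not> p dvd m" and odd: "odd p"
    and n: "n \<le> p"
  shows "multiplicity p (\<Prod>i<n. q ^ n - q ^ i) = (if n = p then p + 1 else n)"
proof -
  have q1: "q > 1" using q prime_gt_0_nat[OF p] by (cases m) auto
  have npq: "\<not> p dvd q" using q(1) p by (metis dvd_add_left_iff dvd_triv_left not_prime_unit)
  have "multiplicity p (\<Prod>i<n. q ^ n - q ^ i) = (\<Sum>i<n. multiplicity p (q ^ n - q ^ i))"
    using q1 by (intro prime_elem_multiplicity_prod_distrib) (auto simp: p image_iff)
  also have "\<dots> = (\<Sum>i<n. multiplicity p (q ^ (n - i) - 1))"
  proof (rule sum.cong)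
    fix i assume "i \<in> {..<n}"
    then have i: "i < n" by simp
    have "q ^ n - q ^ i = q ^ i * (q ^ (n - i) - 1)"
      using i by (simp add: diff_mult_distrib2 power_add[symmetric])
    moreover have "multiplicity p (q ^ i) = 0"
      using npq p by (metis not_dvd_imp_multiplicity_0 prime_dvd_power)
    moreover have "q ^ i \<noteq> 0" "q ^ (n - i) - 1 \<noteq> 0"
      using q1 i one_less_power[of q "n - i"] by auto
    ultimately show "multiplicity p (q ^ n - q ^ i) = multiplicity p (q ^ (n - i) - 1)"
      using p by (simp add: prime_elem_multiplicity_mult_distrib)
  qed simp
  also have "\<dots> = (\<Sum>i<n. if i = 0 \<and> n = p then 2 else 1)"
  proof (rule sum.cong)
    fix i assume "i \<in> {..<n}"
    then show "multiplicity p (q ^ (n - i) - 1) = (if i = 0 \<and> n = p then 2 else 1)"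
      using multiplicity_power_minus_1_less[OF p q, of "n - i"] multiplicity_power_minus_1_eq[OF p q odd] n
      by auto
  qed simp
  also have "\<dots> = (if n = p then p + 1 else n)"
  proof (cases "n = p")
    case True
    then obtain k where "n = Suc k" using prime_gt_0_nat[OF p] by (cases n) auto
    then show ?thesis using True by (simp only: sum.lessThan_Suc_shift) auto
  qed auto
  finally show ?thesis .
qed

text \<open>Otherwise the characteristic would divide both \<open>CARD('a)\<close> and
  \<open>CARD('a) - 1\<close>.\<close>

lemma of_nat_neq_0_field:
  assumes "p dvd CARD('a::{finite,field}) - 1"
  shows "of_nat p \<noteq> (0::'a)"
proof
  assume "of_nat p = (0::'a)"
  then have "CHAR('a) dvd CARD('a) - 1" using assms dvd_trans
    by (metis of_nat_eq_0_iff_char_dvd)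
  moreover have "CHAR('a) dvd CARD('a)" by (rule CHAR_dvd_CARD)
  ultimately have "CHAR('a) dvd 1"
    by (metis One_nat_def Suc_pred' dvd_add_right_iff finite_UNIV_card_ge_0 finite plus_1_eq_Suc add.commute)
  then show False by simp
qed

section \<open>Cyclically shifted diagonal matrices\<close>

text \<open>The entry \<open>d c\<close> sits in column \<open>c\<close>, so that products need no subtraction of indices.\<close>

definition cyc_mat :: "nat \<Rightarrow> nat \<Rightarrow> (nat \<Rightarrow> 'a) \<Rightarrow> 'a::field mat" where
  "cyc_mat n k d = mat n n (\<lambda>(r, c). if r = (c + k) mod n then d c else 0)"

lemma cyc_mat_carrier [simp]: "cyc_mat n k d \<in> carrier_mat n n"
  and dim_row_cyc_mat [simp]: "dim_row (cyc_mat n k d) = n"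
  and dim_col_cyc_mat [simp]: "dim_col (cyc_mat n k d) = n"
  by (auto simp: cyc_mat_def)

lemma cyc_mat_index:
  "r < n \<Longrightarrow> c < n \<Longrightarrow> cyc_mat n k d $$ (r, c) = (if r = (c + k) mod n then d c else 0)"
  by (simp add: cyc_mat_def)

lemma cyc_mat_cong:
  assumes "k mod n = l mod n" "\<And>c. c < n \<Longrightarrow> d c = e c"
  shows "cyc_mat n k d = cyc_mat n l e"
  using assms by (intro eq_matI) (auto simp: cyc_mat_index mod_add_cong[of c n c k l] intro: mod_add_cong)

lemma one_mat_cyc_mat: "1\<^sub>m n = cyc_mat n 0 (\<lambda>_. 1)"
  by (intro eq_matI) (auto simp: cyc_mat_index)

lemma index_mult_cyc_mat:
  assumes "A \<in> carrier_mat m n" "r < m" "c < n"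
  shows "(A * cyc_mat n k d) $$ (r, c) = A $$ (r, (c + k) mod n) * d c"
proof -
  have "(A * cyc_mat n k d) $$ (r, c) = (\<Sum>i<n. A $$ (r, i) * (if i = (c + k) mod n then d c else 0))"
    using assms by (simp add: scalar_prod_def cyc_mat_index atLeast0LessThan)
  also have "\<dots> = (\<Sum>i<n. if i = (c + k) mod n then A $$ (r, i) * d c else 0)"
    by (rule sum.cong) auto
  also have "\<dots> = A $$ (r, (c + k) mod n) * d c" using assms by (simp add: sum.delta)
  finally show ?thesis .
qed

lemma add_mod_inj:
  fixes a b k n :: nat
  assumes "a < n" "b < n" "(a + k) mod n = (b + k) mod n" shows "a = b"
proof -
  have "[a = b] (mod n)" using assms(3) by (metis cong_def cong_add_rcancel_nat)
  then show ?thesis using assms by (metis cong_less_modulus_unique_nat)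
qed

lemma index_cyc_mat_mult:
  assumes "A \<in> carrier_mat n m" "s < n" "c < m"
  shows "(cyc_mat n k d * A) $$ ((s + k) mod n, c) = d s * A $$ (s, c)"
proof -
  have "(cyc_mat n k d * A) $$ ((s + k) mod n, c)
      = (\<Sum>i<n. (if (s + k) mod n = (i + k) mod n then d i else 0) * A $$ (i, c))"
    using assms by (simp add: scalar_prod_def cyc_mat_index atLeast0LessThan)
  also have "\<dots> = (\<Sum>i<n. if i = s then d i * A $$ (i, c) else 0)"
    by (rule sum.cong) (use assms in \<open>auto dest: add_mod_inj\<close>)
  also have "\<dots> = d s * A $$ (s, c)" using assms by (simp add: sum.delta)
  finally show ?thesis .
qed

text \<open>The right factor moves column \<open>c\<close> to position \<open>c + l\<close>, where
  the left factor then applies its weight.\<close>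

lemma cyc_mat_mult:
  "cyc_mat n k d * cyc_mat n l e = cyc_mat n (k + l) (\<lambda>c. d ((c + l) mod n) * e c)"
proof (rule eq_matI)
  fix r c assume "r < dim_row (cyc_mat n (k + l) (\<lambda>c. d ((c + l) mod n) * e c))"
    "c < dim_col (cyc_mat n (k + l) (\<lambda>c. d ((c + l) mod n) * e c))"
  then have rc: "r < n" "c < n" by auto
  have "((c + l) mod n + k) mod n = (c + (k + l)) mod n" by (simp add: mod_simps ac_simps)
  then show "(cyc_mat n k d * cyc_mat n l e) $$ (r, c) = cyc_mat n (k + l) (\<lambda>c. d ((c + l) mod n) * e c) $$ (r, c)"
    unfolding index_mult_cyc_mat[OF cyc_mat_carrier rc] using rc by (simp add: cyc_mat_index)
qed simp_all

lemma cyc_mat_eqD: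
  assumes "cyc_mat n k d = cyc_mat n l e" "c < n" "d c \<noteq> 0"
  shows "k mod n = l mod n" "d c = e c"
proof -
  have n: "(c + k) mod n < n" using assms(2) by simp
  have "cyc_mat n k d $$ ((c + k) mod n, c) = cyc_mat n l e $$ ((c + k) mod n, c)" using assms(1) by simp
  then have *: "(c + k) mod n = (c + l) mod n" "d c = e c"
    using assms(2,3) n by (auto simp: cyc_mat_index split: if_splits)
  then have "[c + k = c + l] (mod n)" by (simp add: cong_def)
  then show "k mod n = l mod n" by (metis cong_def cong_add_lcancel_nat)
  show "d c = e c" by fact
qed

lemma cyc_mat_inverse:
  fixes d :: "nat \<Rightarrow> 'a::field"
  assumes d: "\<And>c. c < n \<Longrightarrow> d c \<noteq> 0" and k: "k < n"
  shows "cyc_mat n k d * cyc_mat n (n - k) (\<lambda>c. inverse (d ((c + (n - k)) mod n))) = 1\<^sub>m n"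
    and "cyc_mat n (n - k) (\<lambda>c. inverse (d ((c + (n - k)) mod n))) * cyc_mat n k d = 1\<^sub>m n"
proof -
  have "((c + k) mod n + (n - k)) mod n = c mod n" for c
  proof -
    have "((c + k) mod n + (n - k)) mod n = (c + k + (n - k)) mod n" by (rule mod_add_left_eq)
    then show ?thesis using k by simp
  qed
  then show "cyc_mat n k d * cyc_mat n (n - k) (\<lambda>c. inverse (d ((c + (n - k)) mod n))) = 1\<^sub>m n"
    and "cyc_mat n (n - k) (\<lambda>c. inverse (d ((c + (n - k)) mod n))) * cyc_mat n k d = 1\<^sub>m n"
    unfolding cyc_mat_mult one_mat_cyc_mat using k d by (auto intro!: cyc_mat_cong)
qed

lemma cyc_mat_in_GL:
  assumes "\<And>c. c < n \<Longrightarrow> d c \<noteq> 0" "k < n"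
  shows "cyc_mat n k d \<in> carrier (GL n)"
  unfolding mem_GL_iff_inverse using cyc_mat_inverse[of n d k, OF assms] cyc_mat_carrier by blast

lemma cyc_mat_pow: "cyc_mat n 0 d ^\<^sub>m j = cyc_mat n 0 (\<lambda>c. d c ^ j)"
  by (induction j) (auto simp: one_mat_cyc_mat cyc_mat_mult mult.commute intro!: cyc_mat_cong)

text \<open>Comparing entries of the two products gives
  \<open>(d c - d r) * B $$ (r, c) = 0\<close>.\<close>

lemma commute_diag_imp_diag:
  assumes B: "B \<in> carrier_mat n n" and comm: "B * cyc_mat n 0 d = cyc_mat n 0 d * B"
    and d: "inj_on d {..<n}"
  shows "B = cyc_mat n 0 (\<lambda>c. B $$ (c, c))"
proof (rule eq_matI)
  fix r c assume "r < dim_row (cyc_mat n 0 (\<lambda>c. B $$ (c, c)))" "c < dim_col (cyc_mat n 0 (\<lambda>c. B $$ (c, c)))"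
  then have rc: "r < n" "c < n" by auto
  have "B $$ (r, c) * d c = d r * B $$ (r, c)"
    using index_mult_cyc_mat[OF B rc, of 0 d] index_cyc_mat_mult[OF B rc, of 0 d] comm rc by simp
  then have "(d c - d r) * B $$ (r, c) = 0" by (simp add: algebra_simps)
  then have "r \<noteq> c \<Longrightarrow> B $$ (r, c) = 0" using d rc by (auto dest: inj_onD)
  then show "B $$ (r, c) = cyc_mat n 0 (\<lambda>c. B $$ (c, c)) $$ (r, c)"
    using rc by (auto simp: cyc_mat_index)
qed (use B in auto)

text \<open>For \<open>K = {0}\<close> this is the diagonal group, for \<open>K = {..<n}\<close> its extension by all cyclic shifts.\<close>

definition cyc_group :: "nat \<Rightarrow> nat \<Rightarrow> nat set \<Rightarrow> 'a::field mat set" where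
  "cyc_group p n K = {cyc_mat n k d | k d. k \<in> K \<and> (\<forall>c<n. d c ^ p = 1)}"

lemma cyc_group_memI:
  assumes "k mod n \<in> K" "\<And>c. c < n \<Longrightarrow> d c ^ p = 1"
  shows "cyc_mat n k d \<in> cyc_group p n K"
proof -
  have "cyc_mat n k d = cyc_mat n (k mod n) d" by (rule cyc_mat_cong) auto
  then show ?thesis using assms unfolding cyc_group_def by blast
qed

lemma cyc_group_subgroup:
  assumes p: "p > 0" and n: "n > 0" and K: "K \<subseteq> {..<n}" "0 \<in> K"
    and add: "\<And>k l. k \<in> K \<Longrightarrow> l \<in> K \<Longrightarrow> (k + l) mod n \<in> K"
    and minus: "\<And>k. k \<in> K \<Longrightarrow> (n - k) mod n \<in> K"
  shows "subgroup (cyc_group p n K) (GL n :: 'a::field mat monoid)"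
proof -
  interpret group "GL n :: 'a mat monoid" by (rule group_GL)
  have nz: "d c \<noteq> 0" if "\<forall>c<n. d c ^ p = 1" "c < n" for d :: "nat \<Rightarrow> 'a" and c
    using that p by (metis power_0_left neq0_conv zero_neq_one)
  show ?thesis
  proof (rule subgroupI)
    show "cyc_group p n K \<subseteq> carrier (GL n :: 'a mat monoid)"
      using nz K by (auto simp: cyc_group_def intro!: cyc_mat_in_GL)
    have "1\<^sub>m n \<in> (cyc_group p n K :: 'a mat set)"
      unfolding one_mat_cyc_mat using K n by (auto intro!: cyc_group_memI)
    then show "cyc_group p n K \<noteq> ({} :: 'a mat set)" by blast
  next
    fix A :: "'a mat" assume "A \<in> cyc_group p n K"
    then obtain k d where A: "A = cyc_mat n k d" "k \<in> K" "\<forall>c<n. d c ^ p = 1" "k < n"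
      using K by (auto simp: cyc_group_def)
    let ?B = "cyc_mat n (n - k) (\<lambda>c. inverse (d ((c + (n - k)) mod n)))"
    have B: "?B \<in> cyc_group p n K"
      using A minus n by (auto intro!: cyc_group_memI simp: power_inverse)
    have c: "A \<in> carrier (GL n)" "?B \<in> carrier (GL n)"
      using A nz n B cyc_mat_inverse[of n d k] by (auto simp: mem_GL_iff_inverse)
    have "inv\<^bsub>GL n\<^esub> A = ?B"
      using c A nz cyc_mat_inverse(2)[of n d k] by (intro inv_equality) auto
    then show "inv\<^bsub>GL n\<^esub> A \<in> cyc_group p n K" using B by simp
  next
    fix A B :: "'a mat" assume "A \<in> cyc_group p n K" "B \<in> cyc_group p n K"
    then obtain k d l e where A: "A = cyc_mat n k d" "k \<in> K" "\<forall>c<n. d c ^ p = 1"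
      and B: "B = cyc_mat n l e" "l \<in> K" "\<forall>c<n. e c ^ p = 1" by (auto simp: cyc_group_def)
    show "A \<otimes>\<^bsub>GL n\<^esub> B \<in> cyc_group p n K"
      unfolding mult_GL A(1) B(1) cyc_mat_mult
      using add A B n by (intro cyc_group_memI) (auto simp: power_mult_distrib)
  qed
qed

text \<open>Roots of unity are nonzero, so the shift and the weights below \<open>n\<close> can be
  read off from the matrix. Extensional functions make the choice of \<open>d\<close>
  unique.\<close>

lemma card_cyc_group:
  assumes n: "n > 0" and p: "p > 0" and K: "K \<subseteq> {..<n}" and card: "card {x::'a::{finite,field}. x ^ p = 1} = p"
  shows "card (cyc_group p n K :: 'a mat set) = card K * p ^ n"
proof -
  let ?F = "{..<n} \<rightarrow>\<^sub>E {x::'a. x ^ p = 1}"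
  have nz: "x \<noteq> 0" if "x ^ p = 1" for x :: 'a
    using that p by (metis power_0_left neq0_conv zero_neq_one)
  have "bij_betw (\<lambda>(k, d). cyc_mat n k d) (K \<times> ?F) (cyc_group p n K)"
    unfolding bij_betw_def
  proof
    show "inj_on (\<lambda>(k, d). cyc_mat n k d) (K \<times> ?F)"
    proof (rule inj_onI, clarify)
      fix k d l e assume H: "k \<in> K" "l \<in> K" "d \<in> ?F" "e \<in> ?F" "cyc_mat n k d = cyc_mat n l e"
      have dnz: "d c \<noteq> 0" if "c < n" for c using H(3) that nz by (auto simp: PiE_iff)
      have "k = l" using cyc_mat_eqD(1)[OF H(5) n dnz[OF n]] H(1,2) K
        by (metis lessThan_iff mod_less subsetD)
      moreover have "d = e"
        using cyc_mat_eqD(2)[OF H(5) _ dnz] H(3,4) by (intro PiE_ext[of d "{..<n}" _ e]) auto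
      ultimately show "k = l \<and> d = e" by simp
    qed
    show "(\<lambda>(k, d). cyc_mat n k d) ` (K \<times> ?F) = cyc_group p n K"
    proof (intro equalityI subsetI)
      fix A assume "A \<in> (cyc_group p n K :: 'a mat set)"
      then obtain k d where A: "A = cyc_mat n k d" "k \<in> K" "\<forall>c<n. d c ^ p = 1"
        by (auto simp: cyc_group_def)
      have "A = cyc_mat n k (restrict d {..<n})" unfolding A(1) by (rule cyc_mat_cong) auto
      moreover have "restrict d {..<n} \<in> ?F" using A(3) by auto
      ultimately show "A \<in> (\<lambda>(k, d). cyc_mat n k d) ` (K \<times> ?F)"
        using A(2) by (intro image_eqI[of _ _ "(k, restrict d {..<n})"]) simp_all
    next
      fix A assume "A \<in> (\<lambda>(k, d). cyc_mat n k d) ` (K \<times> ?F)"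
      then show "A \<in> cyc_group p n K" by (force simp: cyc_group_def PiE_iff)
    qed
  qed
  then have "card (cyc_group p n K :: 'a mat set) = card (K \<times> ?F)" by (simp add: bij_betw_same_card)
  then show ?thesis using card by (simp add: card_cartesian_product card_PiE)
qed

lemma pow_mat_Suc2:
  fixes A :: "'a::semiring_1 mat"
  assumes A: "A \<in> carrier_mat n n" shows "A ^\<^sub>m Suc k = A * A ^\<^sub>m k"
proof (induction k)
  case (Suc k)
  have "A ^\<^sub>m Suc (Suc k) = A * A ^\<^sub>m k * A" using Suc by simp
  also have "\<dots> = A * (A ^\<^sub>m k * A)" using A by (intro assoc_mult_mat[of _ n n _ n _ n]) auto
  finally show ?case by simp
qed (use A in simp)

lemma cyc_mat_pow_shift: "\<exists>e. cyc_mat n k d ^\<^sub>m i = cyc_mat n (k * i) e"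
proof (induction i)
  case 0
  show ?case by (auto simp: one_mat_cyc_mat)
next
  case (Suc i)
  then obtain e where "cyc_mat n k d ^\<^sub>m i = cyc_mat n (k * i) e" by blast
  then show ?case by (auto simp: cyc_mat_mult add.commute)
qed

section \<open>Sylow subgroups of the general linear group\<close>

text \<open>The root \<open>w\<close> exists by \<open>ex_nontrivial_root_of_unity\<close>; fixing
  it allows every \<open>p\<close>-th root of unity to be written as a power of
  \<open>w\<close>.\<close>

locale GL_root_of_unity =
  fixes p :: nat and w :: "'a::{finite,field}"
  assumes prime_p: "Factorial_Ring.prime p" and odd_p: "odd p"
    and p_dvd: "p dvd CARD('a) - 1" and p2_not_dvd: "\<not> p\<^sup>2 dvd CARD('a) - 1"
    and w_pow: "w ^ p = 1" and w_neq_1: "w \<noteq> 1"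
begin

text \<open>For \<open>n \<le> p\<close> the diagonal entries are distinct, so only diagonal
  matrices commute with it; for \<open>n = p\<close> they are all the \<open>p\<close>-th roots of
  unity.\<close>

abbreviation W :: "nat \<Rightarrow> 'a mat" where "W n \<equiv> cyc_mat n 0 (\<lambda>i. w ^ i)"

lemma p_ge_3: "p \<ge> 3"
  using prime_ge_2_nat[OF prime_p] odd_p by (cases "p = 2") auto

lemma p_pos: "p > 0" using p_ge_3 by simp

lemma root_nonzero: "x \<noteq> 0" if "x ^ p = 1" for x :: 'a
  using that p_pos by (metis power_0_left neq0_conv zero_neq_one)

lemma w_power_root: "(w ^ i) ^ p = 1"
  by (metis power_mult mult.commute w_pow power_one)

lemma multiplicity_order_GL:
  assumes "n \<le> p"
  shows "multiplicity p (Coset.order (GL n :: 'a mat monoid)) = (if n = p then p + 1 else n)"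
proof -
  obtain m where m: "CARD('a) - 1 = p * m" using p_dvd by (auto elim: dvdE)
  then have "CARD('a) = 1 + p * m" using finite_UNIV_card_ge_0[where 'a = 'a, OF finite]
    by linarith
  moreover have "\<not> p dvd m" using m p2_not_dvd by (auto simp: power2_eq_square)
  ultimately show ?thesis
    unfolding order_GL using multiplicity_prod_power_diff[OF prime_p _ _ odd_p assms] by blast
qed

lemma card_roots: "card {x::'a. x ^ p = 1} = p"
  using roots_of_unity_eq(2)[OF prime_p w_pow w_neq_1] .

lemma diag_group_Sylow:
  assumes "0 < n" "n < p"
  shows "cyc_group p n {0} \<in> Sylow_subgroups (GL n :: 'a mat monoid) p"
  using assms card_cyc_group[OF _ p_pos _ card_roots, of n "{0}"] multiplicity_order_GL[of n]
    cyc_group_subgroup[OF p_pos, of n "{0}", where 'a = 'a]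
  by (auto simp: Sylow_subgroups_def)

text \<open>The \<open>p\<close> shifts account for the extra factor in
  \<open>p ^ (p + 1)\<close>.\<close>

lemma wreath_group_Sylow: "cyc_group p p {..<p} \<in> Sylow_subgroups (GL p :: 'a mat monoid) p"
  using card_cyc_group[OF p_pos p_pos _ card_roots, of "{..<p}"] multiplicity_order_GL[of p]
    cyc_group_subgroup[OF p_pos p_pos, of "{..<p}", where 'a = 'a] p_pos
  by (auto simp: Sylow_subgroups_def)

text \<open>Let \<open>P\<close>, the conjugate of \<open>?D\<close> by \<open>g\<close>, be missing
  from the cover. A member \<open>Q\<close> of the cover contains the conjugate \<open>x\<close> of
  \<open>W n\<close>. Moved back by \<open>g\<close>, the abelian group \<open>Q\<close> centralizes
  \<open>W n\<close>, so it is diagonal, and exponent \<open>p\<close> puts it into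
  \<open>?D\<close>. Thus \<open>Q = P\<close>.\<close>

lemma no_redundant_Sylow:
  assumes n: "0 < n" "n < p"
  shows "\<not> has_redundant_Sylow (GL n :: 'a mat monoid) p"
proof
  interpret group "GL n :: 'a mat monoid" by (rule group_GL)
  let ?G = "GL n :: 'a mat monoid"
  let ?D = "cyc_group p n {0} :: 'a mat set"
  have fin: "finite (carrier ?G)" by (rule finite_GL)
  have D: "?D \<in> Sylow_subgroups ?G p" by (rule diag_group_Sylow[OF n])
  then have DG: "?D \<subseteq> carrier ?G" by (auto simp: Sylow_subgroups_def dest: subgroup.mem_carrier)
  have WD: "W n \<in> ?D" using w_power_root by (intro cyc_group_memI) auto
  have comm: "A * B = B * A" if "A \<in> ?D" "B \<in> ?D" for A B
    using that by (auto simp: cyc_group_def cyc_mat_mult mult.commute intro!: cyc_mat_cong)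
  assume "has_redundant_Sylow ?G p"
  then obtain S where S: "S \<subset> Sylow_subgroups ?G p" "p_elements ?G p \<subseteq> \<Union>S"
    by (auto simp: has_redundant_Sylow_def)
  then obtain P where P: "P \<in> Sylow_subgroups ?G p" "P \<notin> S" by blast
  obtain g where g: "g \<in> carrier ?G" "P = conj_set g ?D" by (rule Sylow_subgroups_conj[OF fin prime_p D P(1)])
  define x where "x = g \<otimes>\<^bsub>?G\<^esub> W n \<otimes>\<^bsub>?G\<^esub> inv\<^bsub>?G\<^esub> g"
  have "x \<in> P" using WD by (auto simp: x_def g conj_set_def)
  then obtain Q where Q: "Q \<in> S" "x \<in> Q"
    using S(2) Sylow_subset_p_elements[OF prime_p P(1)] by blast
  then have QS: "Q \<in> Sylow_subgroups ?G p" using S(1) by blast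
  obtain h where h: "h \<in> carrier ?G" "Q = conj_set h ?D" by (rule Sylow_subgroups_conj[OF fin prime_p D QS])
  \<comment> \<open>Moving back by \<open>g\<close> turns \<open>Q\<close> into the conjugate of
    \<open>?D\<close> by \<open>k\<close>, and \<open>x\<close> into \<open>W n\<close>.\<close>
  define k where "k = inv\<^bsub>?G\<^esub> g \<otimes>\<^bsub>?G\<^esub> h"
  have k: "k \<in> carrier ?G" using g h by (simp add: k_def del: mult_GL)
  have conj: "inv\<^bsub>?G\<^esub> g \<otimes>\<^bsub>?G\<^esub> (h \<otimes>\<^bsub>?G\<^esub> a \<otimes>\<^bsub>?G\<^esub> inv\<^bsub>?G\<^esub> h) \<otimes>\<^bsub>?G\<^esub> g = k \<otimes>\<^bsub>?G\<^esub> a \<otimes>\<^bsub>?G\<^esub> inv\<^bsub>?G\<^esub> k"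
    if "a \<in> ?D" for a
    using that DG g h by (simp add: k_def m_assoc inv_mult_group subset_iff del: mult_GL)
  obtain b where b: "b \<in> ?D" "x = h \<otimes>\<^bsub>?G\<^esub> b \<otimes>\<^bsub>?G\<^esub> inv\<^bsub>?G\<^esub> h" using Q(2) h(2) by (auto simp: conj_set_def)
  have Wk: "W n = k \<otimes>\<^bsub>?G\<^esub> b \<otimes>\<^bsub>?G\<^esub> inv\<^bsub>?G\<^esub> k"
  proof -
    have "inv\<^bsub>?G\<^esub> g \<otimes>\<^bsub>?G\<^esub> x \<otimes>\<^bsub>?G\<^esub> g = W n"
      using g WD DG unfolding x_def by (intro conj_inv_conj) auto
    then show ?thesis using conj[OF b(1)] b(2) by simp
  qed
  have "Q \<subseteq> P"
  proof
    fix z assume "z \<in> Q"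
    then obtain a where a: "a \<in> ?D" "z = h \<otimes>\<^bsub>?G\<^esub> a \<otimes>\<^bsub>?G\<^esub> inv\<^bsub>?G\<^esub> h" using h(2) by (auto simp: conj_set_def)
    define y where "y = k \<otimes>\<^bsub>?G\<^esub> a \<otimes>\<^bsub>?G\<^esub> inv\<^bsub>?G\<^esub> k"
    have aG: "a \<in> carrier ?G" "b \<in> carrier ?G" using a b DG by auto
    have yG: "y \<in> carrier ?G" using k aG by (simp add: y_def del: mult_GL)
    have "y \<otimes>\<^bsub>?G\<^esub> W n = W n \<otimes>\<^bsub>?G\<^esub> y"
      unfolding Wk y_def using conj_mult[OF k aG] conj_mult[OF k aG(2,1)] comm[OF a(1) b(1)] by simp
    then have ydiag: "y = cyc_mat n 0 (\<lambda>c. y $$ (c, c))"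
      using yG power_inj_root_of_unity[OF prime_p w_pow w_neq_1] n
      by (intro commute_diag_imp_diag[where d = "\<lambda>i. w ^ i"]) (auto intro!: inj_onI)
    obtain d where d: "a = cyc_mat n 0 d" "\<forall>c<n. d c ^ p = 1" using a(1) by (auto simp: cyc_group_def)
    have "a ^\<^sub>m p = 1\<^sub>m n" unfolding d(1) cyc_mat_pow one_mat_cyc_mat
      using d(2) by (intro cyc_mat_cong) auto
    then have ap: "a [^]\<^bsub>?G\<^esub> p = \<one>\<^bsub>?G\<^esub>" using aG by (simp add: pow_GL GL_carrier_mat)
    \<comment> \<open>\<open>y\<close> inherits exponent \<open>p\<close> from \<open>a\<close>, so
      its diagonal entries are \<open>p\<close>-th roots of unity.\<close>
    have "y [^]\<^bsub>?G\<^esub> p = \<one>\<^bsub>?G\<^esub>"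
      unfolding y_def conj_nat_pow[OF k aG(1)] ap using k by (simp del: mult_GL one_GL)
    moreover have "y ^\<^sub>m p = cyc_mat n 0 (\<lambda>c. (y $$ (c, c)) ^ p)"
      by (subst ydiag) (rule cyc_mat_pow)
    ultimately have "cyc_mat n 0 (\<lambda>c. (y $$ (c, c)) ^ p) = cyc_mat n 0 (\<lambda>_. 1)"
      using yG by (simp add: pow_GL GL_carrier_mat one_mat_cyc_mat)
    then have "(y $$ (c, c)) ^ p = 1" if "c < n" for c
      using cyc_mat_eqD(2)[of n 0 "\<lambda>_. 1" 0 "\<lambda>c. (y $$ (c, c)) ^ p" c] that by simp
    then have "y \<in> ?D" by (subst ydiag) (auto intro!: cyc_group_memI)
    moreover have "z = g \<otimes>\<^bsub>?G\<^esub> y \<otimes>\<^bsub>?G\<^esub> inv\<^bsub>?G\<^esub> g"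
    proof -
      have zG: "z \<in> carrier ?G" using a aG h by (simp del: mult_GL)
      have "y = inv\<^bsub>?G\<^esub> g \<otimes>\<^bsub>?G\<^esub> z \<otimes>\<^bsub>?G\<^esub> g" using conj[OF a(1)] a(2) by (simp add: y_def)
      then show ?thesis using zG g conj_inv_conj[of "inv\<^bsub>?G\<^esub> g" z] by (simp del: mult_GL)
    qed
    ultimately show "z \<in> P" by (auto simp: g(2) conj_set_def)
  qed
  moreover have "card Q = card P" "finite P"
    using QS P(1) fin by (auto simp: Sylow_subgroups_def dest!: subgroup.subset intro: finite_subset)
  ultimately have "Q = P" by (metis card_subset_eq)
  then show False using Q(1) P(2) by simp
qed

section \<open>The case n = p: two Sylow subgroups through every element\<close>

lemma root_sum_zero: "(\<Sum>i<p. y ^ i) = 0" if "y ^ p = 1" "y \<noteq> 1" for y :: 'a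
  using geometric_sum[of y p] that by simp

text \<open>The columns of \<open>g\<close> are eigenvectors, which gives
  \<open>x * g = g * W p\<close>. Since the eigenvalues are distinct, the columns are independent
  and \<open>g\<close> is invertible.\<close>

lemma diagonalizable_by_GL:
  assumes x: "x \<in> carrier_mat p p"
    and eig: "\<And>k. k < p \<Longrightarrow> \<exists>v\<in>carrier_vec p. v \<noteq> 0\<^sub>v p \<and> x *\<^sub>v v = w ^ k \<cdot>\<^sub>v v"
  shows "\<exists>g\<in>carrier (GL p). x * g = g * W p"
proof -
  obtain V where V: "\<And>k. k < p \<Longrightarrow> V k \<in> carrier_vec p" "\<And>k. k < p \<Longrightarrow> V k \<noteq> 0\<^sub>v p"
    "\<And>k. k < p \<Longrightarrow> x *\<^sub>v V k = w ^ k \<cdot>\<^sub>v V k" using eig by metis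
  define g where "g = mat p p (\<lambda>(r, c). V c $ r)"
  have g: "g \<in> carrier_mat p p" by (simp add: g_def)
  have eigV: "(\<Sum>s<p. x $$ (r, s) * V k $ s) = w ^ k * V k $ r" if "r < p" "k < p" for r k
  proof -
    have "(x *\<^sub>v V k) $ r = (\<Sum>s<p. x $$ (r, s) * V k $ s)"
      using that x V(1)[OF that(2)] by (auto simp: scalar_prod_def atLeast0LessThan)
    then show ?thesis using V(1)[OF that(2)] V(3)[OF that(2)] that by simp
  qed
  have "x * g = g * W p"
  proof (rule eq_matI)
    fix r c assume "r < dim_row (g * W p)" "c < dim_col (g * W p)"
    then have rc: "r < p" "c < p" using g by auto
    have "(x * g) $$ (r, c) = (\<Sum>s<p. x $$ (r, s) * V c $ s)"
      using rc x by (auto simp: g_def scalar_prod_def atLeast0LessThan)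
    then show "(x * g) $$ (r, c) = (g * W p) $$ (r, c)"
      unfolding index_mult_cyc_mat[OF g rc] using eigV[OF rc] rc by (simp add: g_def)
  qed (use x g in auto)
  moreover have "g \<in> carrier (GL p)" unfolding mem_GL_iff_inj
  proof (intro conjI ballI impI)
    fix a assume a: "a \<in> carrier_vec p" "g *\<^sub>v a = 0\<^sub>v p"
    \<comment> \<open>\<open>E i r\<close> is row \<open>r\<close> of \<open>x\<^sup>i g a\<close>; a discrete Fourier transform in \<open>i\<close> isolates each \<open>a $ m\<close>.\<close>
    define E where "E = (\<lambda>i r. \<Sum>k<p. V k $ r * ((w ^ k) ^ i * a $ k))"
    have E0: "E i r = 0" if "r < p" for i r using that
    proof (induction i arbitrary: r)
      case 0
      have "(g *\<^sub>v a) $ r = E 0 r"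
        using 0 a(1) by (auto simp: E_def g_def scalar_prod_def atLeast0LessThan)
      then show ?case using a(2) 0 by simp
    next
      case (Suc i)
      have "E (Suc i) r = (\<Sum>k<p. (w ^ k * V k $ r) * ((w ^ k) ^ i * a $ k))"
        unfolding E_def by (rule sum.cong) (auto simp: algebra_simps)
      also have "\<dots> = (\<Sum>k<p. (\<Sum>s<p. x $$ (r, s) * V k $ s) * ((w ^ k) ^ i * a $ k))"
        by (rule sum.cong) (use eigV Suc in auto)
      also have "\<dots> = (\<Sum>k<p. \<Sum>s<p. x $$ (r, s) * (V k $ s * ((w ^ k) ^ i * a $ k)))"
        by (simp add: sum_distrib_right mult.assoc)
      also have "\<dots> = (\<Sum>s<p. x $$ (r, s) * E i s)"
        unfolding E_def by (subst sum.swap) (simp add: sum_distrib_left)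
      also have "\<dots> = 0" using Suc.IH by simp
      finally show ?case .
    qed
    show "a = 0\<^sub>v p"
    proof (rule eq_vecI)
      fix m assume "m < dim_vec (0\<^sub>v p :: 'a vec)"
      then have m: "m < p" by simp
      obtain r where r: "r < p" "V m $ r \<noteq> 0"
        using V(1,2)[OF m] by (metis eq_vecI carrier_vecD dim_vec index_zero_vec)
      \<comment> \<open>Orthogonality of characters; the exponent \<open>p - m + k\<close> stands
        for \<open>k - m\<close>, which could be negative.\<close>
      have y: "(\<Sum>i<p. (w ^ (p - m + k)) ^ i) = (if k = m then of_nat p else 0)" if k: "k < p" for k
      proof (cases "k = m")
        case True
        then have "p - m + k = p" using m by simp
        then show ?thesis using True w_pow by simp
      next
        case False
        have "w ^ (p - m + k) \<noteq> 1"
        proof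
          assume "w ^ (p - m + k) = 1"
          then have "w ^ m = w ^ (p - m + k) * w ^ m" by simp
          also have "\<dots> = w ^ (p - m + k + m)" by (simp only: power_add)
          also have "p - m + k + m = p + k" using m by simp
          also have "w ^ (p + k) = w ^ k" using w_pow by (simp add: power_add)
          finally show False
            using power_inj_root_of_unity[OF prime_p w_pow w_neq_1 _ m k] False by simp
        qed
        then show ?thesis using False root_sum_zero[OF w_power_root] by simp
      qed
      have "0 = (\<Sum>i<p. (w ^ (p - m)) ^ i * E i r)" using E0 r by simp
      also have "\<dots> = (\<Sum>i<p. \<Sum>k<p. V k $ r * a $ k * (w ^ (p - m + k)) ^ i)"
        unfolding E_def sum_distrib_left
        by (intro sum.cong refl) (simp add: power_add power_mult_distrib algebra_simps)
      also have "\<dots> = (\<Sum>k<p. V k $ r * a $ k * (\<Sum>i<p. (w ^ (p - m + k)) ^ i))"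
        by (subst sum.swap) (simp add: sum_distrib_left)
      also have "\<dots> = (\<Sum>k<p. if k = m then V k $ r * a $ k * of_nat p else 0)"
        by (intro sum.cong refl) (simp add: y)
      also have "\<dots> = V m $ r * a $ m * of_nat p" using m by (simp add: sum.delta)
      finally show "a $ m = 0\<^sub>v p $ m" using r(2) m of_nat_neq_0_field[OF p_dvd] by simp
    qed (use a in auto)
  qed (rule g)
  ultimately show ?thesis by blast
qed

lemma in_two_Sylows_transfer:
  fixes x y g :: "'a mat"
  assumes "x \<in> carrier (GL p)" "y \<in> carrier (GL p)" "g \<in> carrier (GL p)" "x * g = g * y"
    and "in_two_Sylows (GL p) p y"
  shows "in_two_Sylows (GL p) p x"
proof -
  interpret group "GL p :: 'a mat monoid" by (rule group_GL)
  have "x = g \<otimes>\<^bsub>GL p\<^esub> y \<otimes>\<^bsub>GL p\<^esub> inv\<^bsub>GL p\<^esub> g"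
    using assms(1-4) inv_solve_right[of x "g * y" g] m_closed[of g y] by simp
  then show ?thesis using in_two_Sylows_conj[OF assms(5,3)] by simp
qed

text \<open>Because \<open>?x ^\<^sub>m p = 1\<^sub>m p\<close>, averaging the orbit of a unit
  vector against powers of \<open>l\<close> yields an eigenvector for any \<open>p\<close>-th root
  of unity \<open>l\<close>.\<close>

lemma cyc_mat_eigenvector:
  fixes d :: "nat \<Rightarrow> 'a"
  assumes k: "0 < k" "k < p" and pow: "cyc_mat p k d ^\<^sub>m p = 1\<^sub>m p" and l: "l ^ p = 1"
  shows "\<exists>v\<in>carrier_vec p. v \<noteq> 0\<^sub>v p \<and> cyc_mat p k d *\<^sub>v v = l \<cdot>\<^sub>v v"
proof -
  let ?x = "cyc_mat p k d"
  \<comment> \<open>\<open>v\<close> is the sum of \<open>l\<^sup>-\<^sup>i x\<^sup>i e\<^sub>0\<close> over \<open>i < p\<close>\<close>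
  define f where "f = (\<lambda>r i. l ^ (p - i) * (?x ^\<^sub>m i) $$ (r, 0))"
  define v where "v = vec p (\<lambda>r. \<Sum>i<p. f r i)"
  have v: "v \<in> carrier_vec p" by (simp add: v_def)
  have "f 0 i = 0" if "0 < i" "i < p" for i
  proof -
    obtain e where "?x ^\<^sub>m i = cyc_mat p (k * i) e" using cyc_mat_pow_shift by blast
    moreover have "\<not> p dvd k * i"
      using k that prime_p by (metis nat_dvd_not_less prime_dvd_mult_iff)
    ultimately show ?thesis using p_pos by (simp add: f_def cyc_mat_index mod_eq_0_iff_dvd)
  qed
  \<comment> \<open>For \<open>0 < i < p\<close> the shift \<open>k * i\<close> is nonzero modulo
    \<open>p\<close>, so only the summand \<open>i = 0\<close> reaches coordinate 0. Hence
    \<open>v\<close> is nonzero.\<close>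
  then have "(\<Sum>i<p. f 0 i) = (\<Sum>i<p. if i = 0 then f 0 i else 0)" by (intro sum.cong) auto
  then have "v $ 0 = 1" using p_pos l by (simp add: v_def f_def sum.delta)
  then have "v \<noteq> 0\<^sub>v p" using p_pos by auto
  moreover have "?x *\<^sub>v v = l \<cdot>\<^sub>v v"
  proof (rule eq_vecI)
    fix r assume "r < dim_vec (l \<cdot>\<^sub>v v)"
    then have r: "r < p" by (simp add: v_def)
    have step: "(\<Sum>s<p. ?x $$ (r, s) * f s i) = l * f r (Suc i)" if "i < p" for i
    proof -
      have "?x ^\<^sub>m Suc i = ?x * ?x ^\<^sub>m i" by (rule pow_mat_Suc2[OF cyc_mat_carrier])
      then have "(?x ^\<^sub>m Suc i) $$ (r, 0) = (\<Sum>s<p. ?x $$ (r, s) * (?x ^\<^sub>m i) $$ (s, 0))"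
        using r p_pos by (simp add: scalar_prod_def atLeast0LessThan)
      moreover have "l * l ^ (p - Suc i) = l ^ (p - i)" using that
        by (metis Suc_diff_Suc power_Suc)
      ultimately show ?thesis
        by (simp add: f_def sum_distrib_left mult.assoc[symmetric] del: pow_mat.simps) (simp add: algebra_simps del: pow_mat.simps)
    qed
    have "(?x *\<^sub>v v) $ r = (\<Sum>s<p. ?x $$ (r, s) * (\<Sum>i<p. f s i))"
      using r by (simp add: v_def scalar_prod_def atLeast0LessThan)
    also have "\<dots> = (\<Sum>i<p. \<Sum>s<p. ?x $$ (r, s) * f s i)"
      by (subst sum.swap) (simp add: sum_distrib_left)
    also have "\<dots> = l * (\<Sum>i<p. f r (Suc i))" using step by (simp add: sum_distrib_left)
    \<comment> \<open>The index is cyclic: the new last summand \<open>f r p\<close> equals the lost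
      first one.\<close>
    also have "(\<Sum>i<p. f r (Suc i)) = (\<Sum>i<p. f r i)"
    proof -
      have "f r p = f r 0" using pow l by (simp add: f_def)
      then show ?thesis using sum.lessThan_Suc_shift[of "f r" p] by simp
    qed
    finally show "(?x *\<^sub>v v) $ r = (l \<cdot>\<^sub>v v) $ r" using r by (simp add: v_def)
  qed (simp add: v_def)
  ultimately show ?thesis using v by blast
qed

text \<open>\<open>k\<close> is invertible modulo the prime \<open>p\<close>, so its multiples reach
  every residue.\<close>

lemma shift_invariant_const:
  fixes k :: nat
  assumes k: "0 < k" "k < p" and f: "\<And>c. c < p \<Longrightarrow> f ((c + k) mod p) = f c" and c: "c < p"
  shows "f c = f 0"
proof -
  have it: "f ((k * i) mod p) = f 0" for i
  proof (induction i)
    case (Suc i)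
    have "(k * Suc i) mod p = ((k * i) mod p + k) mod p" by (simp add: mod_simps add.commute)
    then show ?case using f[of "(k * i) mod p"] Suc p_pos by simp
  qed simp
  have "coprime k p" using k prime_p by (metis coprime_commute nat_dvd_not_less prime_imp_coprime_nat)
  then obtain i where "[k * i = c] (mod p)" using cong_solve_coprime_nat[of k p]
    by (metis cong_scalar_right mult.assoc mult_1 One_nat_def)
  then have "(k * i) mod p = c" using c by (simp add: cong_def)
  then show ?thesis using it[of i] by simp
qed

abbreviation P where "P \<equiv> cyc_group p p {..<p} :: 'a mat set"

lemma P_carrier: "x \<in> P \<Longrightarrow> x \<in> carrier (GL p)"
  using wreath_group_Sylow by (auto simp: Sylow_subgroups_def dest: subgroup.mem_carrier)

lemma P_obtain:
  assumes "x \<in> P"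
  obtains k d where "x = cyc_mat p k d" "k < p" "\<And>c. c < p \<Longrightarrow> d c ^ p = 1" "\<And>c. c < p \<Longrightarrow> d c \<noteq> 0"
  using assms root_nonzero unfolding cyc_group_def by blast

lemma in_two_Sylows_commuting:
  assumes x: "x \<in> P" and g: "g \<in> carrier (GL p)" "g * x = x * g"
    and y: "y \<in> P" "\<And>m. m \<in> P \<Longrightarrow> g * y \<noteq> m * g"
  shows "in_two_Sylows (GL p) p x"
  using group.in_two_Sylows_if_commutes[OF group_GL wreath_group_Sylow x g(1)] g(2) y by simp

text \<open>A test element of \<open>P\<close> that rescales a single column; it serves as
  \<open>y\<close> in \<open>in_two_Sylows_commuting\<close> and separates the Sylow subgroups
  through \<open>W p\<close>.\<close>

definition bump :: "nat \<Rightarrow> 'a mat" where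
  "bump i = cyc_mat p 0 (\<lambda>c. if c = i then w else 1)"

lemma bump_in_P: "bump i \<in> P"
  unfolding bump_def using w_pow p_pos by (intro cyc_group_memI) auto

lemma sigma_pow: "cyc_mat p 1 (\<lambda>_. 1::'a) ^\<^sub>m l = cyc_mat p l (\<lambda>_. 1)"
  by (induction l) (auto simp: one_mat_cyc_mat cyc_mat_mult intro!: cyc_mat_cong)

text \<open>The shift \<open>?s\<close> has every \<open>p\<close>-th root of unity as an
  eigenvalue, so it is conjugate to \<open>W p\<close>, and \<open>W p\<close> lies in the conjugate
  \<open>?R\<close> of \<open>P\<close>. The two groups differ: \<open>bump 0\<close> is in
  \<open>P\<close> and commutes with \<open>W p\<close>, whereas the elements of \<open>?R\<close>
  that commute with \<open>W p\<close> are scalar multiples of its powers.\<close>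

lemma in_two_Sylows_W: "in_two_Sylows (GL p) p (W p)"
proof -
  interpret group "GL p :: 'a mat monoid" by (rule group_GL)
  let ?G = "GL p :: 'a mat monoid" and ?s = "cyc_mat p 1 (\<lambda>_. 1::'a)"
  have "?s ^\<^sub>m p = 1\<^sub>m p" unfolding sigma_pow one_mat_cyc_mat by (rule cyc_mat_cong) auto
  then obtain g where g: "g \<in> carrier ?G" "?s * g = g * W p"
    using diagonalizable_by_GL[OF cyc_mat_carrier] cyc_mat_eigenvector[of 1 "\<lambda>_. 1"] w_power_root p_ge_3
    by (metis One_nat_def lessI less_le_trans numeral_3_eq_3 zero_less_one Suc_lessD)
  have sP: "?s \<in> P" using p_ge_3 by (intro cyc_group_memI) auto
  have WP: "W p \<in> P" using w_power_root p_pos by (intro cyc_group_memI) auto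
  have car: "?s \<in> carrier ?G" "W p \<in> carrier ?G" "bump 0 \<in> carrier ?G"
    using P_carrier sP WP bump_in_P by auto
  note mat = GL_carrier_mat[OF g(1)] GL_carrier_mat[OF car(1)] GL_carrier_mat[OF car(2)] GL_carrier_mat[OF car(3)]
  let ?R = "conj_set (inv\<^bsub>?G\<^esub> g) P"
  have R: "?R \<in> Sylow_subgroups ?G p" using conj_set_Sylow[OF wreath_group_Sylow] g by simp
  have "W p = inv\<^bsub>?G\<^esub> g \<otimes>\<^bsub>?G\<^esub> ?s \<otimes>\<^bsub>?G\<^esub> inv\<^bsub>?G\<^esub> (inv\<^bsub>?G\<^esub> g)"
  proof -
    have "g \<otimes>\<^bsub>?G\<^esub> W p = ?s \<otimes>\<^bsub>?G\<^esub> g" using g by simp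
    then have "W p = inv\<^bsub>?G\<^esub> g \<otimes>\<^bsub>?G\<^esub> (?s \<otimes>\<^bsub>?G\<^esub> g)" using g car inv_solve_left by (metis m_closed)
    then show ?thesis using g car by (simp add: m_assoc del: mult_GL)
  qed
  then have WR: "W p \<in> ?R" using sP unfolding conj_set_def by blast
  have "bump 0 \<notin> ?R"
  proof
    assume "bump 0 \<in> ?R"
    then obtain u where u: "u \<in> P" "bump 0 = inv\<^bsub>?G\<^esub> g \<otimes>\<^bsub>?G\<^esub> u \<otimes>\<^bsub>?G\<^esub> g"
      using g(1) by (auto simp: conj_set_def)
    have uG: "u \<in> carrier ?G" using P_carrier u by simp
    have "g \<otimes>\<^bsub>?G\<^esub> bump 0 = u \<otimes>\<^bsub>?G\<^esub> g"
      unfolding u(2) using uG g(1) by (simp add: m_assoc[symmetric] del: mult_GL one_GL)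
    then have ge: "g * bump 0 = u * g" by simp
    have mu: "u \<in> carrier_mat p p" using uG by auto
    \<comment> \<open>\<open>bump 0\<close> commutes with \<open>W p\<close>; carried over by
      \<open>g\<close>, this says that \<open>u\<close> commutes with \<open>?s\<close>.\<close>
    have "u * ?s * g = u * (g * W p)" using g(2) mat mu by (simp add: assoc_mult_mat[of _ p p _ p _ p])
    also have "\<dots> = g * (bump 0 * W p)" using ge mat mu by (simp add: assoc_mult_mat[of _ p p _ p _ p, symmetric])
    also have "bump 0 * W p = W p * bump 0" unfolding bump_def cyc_mat_mult by (rule cyc_mat_cong) (auto simp: mult.commute)
    also have "g * (W p * bump 0) = ?s * g * bump 0"
      unfolding g(2) using mat by (intro assoc_mult_mat[symmetric, of _ p p _ p _ p])
    also have "\<dots> = ?s * (g * bump 0)" using mat by (intro assoc_mult_mat[of _ p p _ p _ p])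
    also have "\<dots> = ?s * u * g" using ge mat mu by (simp add: assoc_mult_mat[of _ p p _ p _ p])
    finally have us: "u * ?s = ?s * u"
      using right_cancel[of g "u * ?s" "?s * u"] g(1) uG car m_closed[of u ?s] m_closed[of ?s u] by simp
    obtain l f where f: "u = cyc_mat p l f" "l < p" "\<And>c. c < p \<Longrightarrow> f c ^ p = 1" "\<And>c. c < p \<Longrightarrow> f c \<noteq> 0"
      using P_obtain[OF u(1)] by blast
    \<comment> \<open>Commuting with the shift makes the weights of \<open>u\<close> constant, so
      \<open>u\<close> is a scalar times a power of \<open>?s\<close>.\<close>
    have "f ((c + 1) mod p) = f c" if "c < p" for c
    proof -
      have "cyc_mat p (l + 1) (\<lambda>c. f ((c + 1) mod p) * 1) = cyc_mat p (1 + l) (\<lambda>c. 1 * f c)"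
        using us unfolding f(1) cyc_mat_mult .
      from cyc_mat_eqD(2)[OF this that] show ?thesis using f(4)[of "(c + 1) mod p"] that by simp
    qed
    then have const0: "f c = f 0" if "c < p" for c
      using shift_invariant_const[of 1 f c] p_ge_3 that by simp
    define a where "a = f 0"
    have const: "f c = a" if "c < p" for c unfolding a_def using const0[OF that] .
    have u': "u = a \<cdot>\<^sub>m ?s ^\<^sub>m l"
      unfolding sigma_pow f(1) by (intro eq_matI) (auto simp: cyc_mat_index const)
    have sg: "?s ^\<^sub>m i * g = g * W p ^\<^sub>m i" for i
    proof (induction i)
      case 0 show ?case using mat by simp
    next
      case (Suc i)
      have "?s ^\<^sub>m Suc i * g = ?s ^\<^sub>m i * (g * W p)" using mat g(2)
        by (simp add: assoc_mult_mat[of _ p p _ p _ p])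
      also have "\<dots> = g * W p ^\<^sub>m i * W p" using mat Suc
        by (simp add: assoc_mult_mat[of _ p p _ p _ p, symmetric])
      also have "\<dots> = g * W p ^\<^sub>m Suc i" using mat by (simp add: assoc_mult_mat[of _ p p _ p _ p])
      finally show ?case .
    qed
    have "u * g = a \<cdot>\<^sub>m (?s ^\<^sub>m l * g)" unfolding u' using mat by (intro mult_smult_assoc_mat) auto
    also have "\<dots> = g * (a \<cdot>\<^sub>m W p ^\<^sub>m l)" unfolding sg using mat by (intro mult_smult_distrib[symmetric]) auto
    also have "a \<cdot>\<^sub>m W p ^\<^sub>m l = cyc_mat p 0 (\<lambda>c. a * (w ^ c) ^ l)"
      unfolding cyc_mat_pow by (intro eq_matI) (auto simp: cyc_mat_index)
    finally have "g \<otimes>\<^bsub>?G\<^esub> bump 0 = g \<otimes>\<^bsub>?G\<^esub> cyc_mat p 0 (\<lambda>c. a * (w ^ c) ^ l)" using ge by simp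
    moreover have "cyc_mat p 0 (\<lambda>c. a * (w ^ c) ^ l) \<in> carrier ?G"
      using f(4)[OF p_pos] const[OF p_pos] root_nonzero[OF w_pow] p_pos by (intro cyc_mat_in_GL) auto
    ultimately have eq: "bump 0 = cyc_mat p 0 (\<lambda>c. a * (w ^ c) ^ l)"
      using g(1) car(3) by (simp del: mult_GL)
    \<comment> \<open>Columns 0, 1 and 2, which exist as \<open>p \<ge> 3\<close>, give
      \<open>a = w\<close>, \<open>a * w ^ l = 1\<close> and \<open>a * w ^ l * w ^ l = 1\<close>;
      hence \<open>w ^ l = 1\<close> and \<open>w = 1\<close>.\<close>
    have e: "(if c = 0 then w else 1) = a * (w ^ c) ^ l" if "c < p" for c
      using cyc_mat_eqD(2)[OF eq[unfolded bump_def] that] root_nonzero[OF w_pow] by auto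
    have "a = w" using e[of 0] p_pos by simp
    moreover have "a * w ^ l = 1" using e[of 1] p_ge_3 by simp
    moreover have "a * w ^ l * w ^ l = 1" using e[of 2] p_ge_3
      by (simp add: power2_eq_square power_mult_distrib mult.assoc)
    ultimately show False using w_neq_1 by simp
  qed
  then have "P \<noteq> ?R" using bump_in_P by blast
  then show ?thesis using WR WP R wreath_group_Sylow unfolding in_two_Sylows_def by blast
qed

text \<open>The transvection \<open>g\<close>, the identity with an extra 1 at
  \<open>(i, j)\<close>, commutes with the diagonal matrix because \<open>d i = d j\<close>, but
  does not conjugate \<open>bump i\<close> into \<open>P\<close>.\<close>

lemma in_two_Sylows_repeated:
  assumes x: "cyc_mat p 0 d \<in> P" and ij: "i < p" "j < p" "i \<noteq> j" "d i = d j"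
  shows "in_two_Sylows (GL p) p (cyc_mat p 0 d)"
proof -
  define g :: "'a mat" where "g = mat p p (\<lambda>(r, c). if r = c \<or> r = i \<and> c = j then 1 else 0)"
  have gm: "g \<in> carrier_mat p p" by (simp add: g_def)
  have g_ix: "g $$ (r, c) = (if r = c \<or> r = i \<and> c = j then 1 else 0)" if "r < p" "c < p" for r c
    using that by (simp add: g_def)
  have gG: "g \<in> carrier (GL p)" unfolding mem_GL_iff_inj
  proof (intro conjI ballI impI)
    fix v assume v: "v \<in> carrier_vec p" "g *\<^sub>v v = 0\<^sub>v p"
    have row: "(\<Sum>c<p. g $$ (r, c) * v $ c) = 0" if "r < p" for r
    proof -
      have "(g *\<^sub>v v) $ r = (\<Sum>c<p. g $$ (r, c) * v $ c)"
        using that v(1) gm by (auto simp: scalar_prod_def atLeast0LessThan)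
      then show ?thesis using v(2) that by simp
    qed
    have z: "v $ r = 0" if r: "r < p" "r \<noteq> i" for r
    proof -
      have "(\<Sum>c<p. g $$ (r, c) * v $ c) = (\<Sum>c<p. if c = r then v $ c else 0)"
        by (rule sum.cong) (use r in \<open>auto simp: g_ix\<close>)
      then show ?thesis using row[OF r(1)] r by (simp add: sum.delta)
    qed
    have "(\<Sum>c<p. g $$ (i, c) * v $ c) = (\<Sum>c<p. if c = i then v $ c else 0)"
      by (rule sum.cong) (use z ij in \<open>auto simp: g_ix\<close>)
    then have "v $ i = 0" using row[OF ij(1)] ij by (simp add: sum.delta)
    then have "v $ r = 0" if "r < p" for r using z[OF that] by (cases "r = i") auto
    then show "v = 0\<^sub>v p" using v(1) by (intro eq_vecI) auto
  qed (rule gm)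
  show ?thesis
  proof (rule in_two_Sylows_commuting[OF x gG _ bump_in_P[of i]])
    show "g * cyc_mat p 0 d = cyc_mat p 0 d * g"
    proof (rule eq_matI)
      fix r c assume "r < dim_row (cyc_mat p 0 d * g)" "c < dim_col (cyc_mat p 0 d * g)"
      then have rc: "r < p" "c < p" using gm by auto
      show "(g * cyc_mat p 0 d) $$ (r, c) = (cyc_mat p 0 d * g) $$ (r, c)"
        using index_mult_cyc_mat[OF gm rc, of 0 d] index_cyc_mat_mult[OF gm rc, of 0 d] rc ij
        by (auto simp: g_ix)
    qed (use gm in auto)
    fix m assume "m \<in> P"
    then obtain l f where m: "m = cyc_mat p l f" "l < p" "\<And>c. c < p \<Longrightarrow> f c \<noteq> 0"
      using P_obtain by metis
    show "g * bump i \<noteq> m * g"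
    proof
      assume eq: "g * bump i = m * g"
      have ent: "g $$ ((s + l) mod p, c) * (if c = i then w else 1) = f s * g $$ (s, c)" if "s < p" "c < p" for s c
        using index_cyc_mat_mult[OF gm that, of l f] index_mult_cyc_mat[OF gm _ that(2), of "(s + l) mod p" 0 "\<lambda>c. if c = i then w else 1"]
          eq that p_pos unfolding m(1) bump_def by simp
      \<comment> \<open>Column \<open>i\<close> of \<open>g\<close> is supported in row
        \<open>i\<close> only, so the shift must fix \<open>i\<close>. Then columns \<open>i\<close>
        and \<open>j\<close> demand \<open>f i = w\<close> and \<open>f i = 1\<close>.\<close>
      have a: "g $$ ((i + l) mod p, i) * w = f i" using ent[of i i] ij by (simp add: g_ix)
      then have "g $$ ((i + l) mod p, i) \<noteq> 0" using m(3)[OF ij(1)] by auto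
      then have il: "(i + l) mod p = i" using ij p_pos by (auto simp: g_ix split: if_splits)
      then have "w = f i" using a ij by (simp add: g_ix)
      moreover have "1 = f i" using ent[of i j] il ij by (simp add: g_ix)
      ultimately show False using w_neq_1 by simp
    qed
  qed
qed

text \<open>The power \<open>?x ^\<^sub>m p\<close> is a scalar \<open>b 0 \<noteq> 1\<close>, which
  makes \<open>g = 1\<^sub>m p + ?x\<close> invertible. It commutes with \<open>?x\<close>, and
  comparing supports shows that it does not conjugate \<open>bump 0\<close> into
  \<open>P\<close>.\<close>

lemma in_two_Sylows_pow_neq_one:
  assumes x: "cyc_mat p k d \<in> P" and k: "0 < k" "k < p" and pow: "cyc_mat p k d ^\<^sub>m p \<noteq> 1\<^sub>m p"
    and d: "\<And>c. c < p \<Longrightarrow> d c \<noteq> 0"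
  shows "in_two_Sylows (GL p) p (cyc_mat p k d)"
proof -
  let ?x = "cyc_mat p k d"
  obtain b where b0: "?x ^\<^sub>m p = cyc_mat p (k * p) b" using cyc_mat_pow_shift by blast
  then have b: "?x ^\<^sub>m p = cyc_mat p 0 b" by (metis cyc_mat_cong mod_mult_self2_is_0 mod_0)
  have powP: "?x ^\<^sub>m i \<in> P" for i
  proof (induction i)
    have "subgroup P (GL p)" using wreath_group_Sylow by (simp add: Sylow_subgroups_def)
    note sub = subgroup.m_closed[OF this] subgroup.one_closed[OF this]
    { case 0 show ?case using sub(2) by simp }
    { case (Suc i) then show ?case using sub(1)[OF Suc x] by simp }
  qed
  obtain l b' where b': "cyc_mat p 0 b = cyc_mat p l b'" "\<And>c. c < p \<Longrightarrow> b' c ^ p = 1" "\<And>c. c < p \<Longrightarrow> b' c \<noteq> 0"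
    using P_obtain[OF powP[of p, unfolded b]] by metis
  have b1: "b c ^ p = 1" "b c \<noteq> 0" if "c < p" for c
    using cyc_mat_eqD(2)[OF b'(1)[symmetric] that b'(3)[OF that]] b'(2,3)[OF that] by auto
  \<comment> \<open>\<open>?x\<close> commutes with its own power, so the weights \<open>b\<close>
    are invariant under the shift by \<open>k\<close>, hence constant.\<close>
  have "?x * ?x ^\<^sub>m p = ?x ^\<^sub>m p * ?x" using pow_mat_Suc2[OF cyc_mat_carrier, of p k d p] by simp
  then have comm: "cyc_mat p (k + 0) (\<lambda>c. d ((c + 0) mod p) * b c) = cyc_mat p (0 + k) (\<lambda>c. b ((c + k) mod p) * d c)"
    unfolding b cyc_mat_mult .
  have "b ((c + k) mod p) = b c" if "c < p" for c
    using cyc_mat_eqD(2)[OF comm that] d[OF that] b1(2)[OF that] that by simp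
  then have const: "b c = b 0" if "c < p" for c
    using shift_invariant_const[of k b c] k that by simp
  have a1: "b 0 \<noteq> 1"
  proof
    assume "b 0 = 1"
    then have "b c = 1" if "c < p" for c using const[OF that] by simp
    then have "cyc_mat p 0 b = 1\<^sub>m p" unfolding one_mat_cyc_mat by (intro cyc_mat_cong) auto
    then show False using pow b by simp
  qed
  define g where "g = 1\<^sub>m p + ?x"
  have gm: "g \<in> carrier_mat p p" by (simp add: g_def)
  \<comment> \<open>A kernel vector of \<open>g\<close> is an eigenvector of \<open>?x\<close> for
    \<open>- 1\<close>; applying \<open>?x ^\<^sub>m p\<close> to it gives \<open>b 0 = - 1\<close>,
    as \<open>p\<close> is odd.\<close>
  have gG: "g \<in> carrier (GL p)" unfolding mem_GL_iff_inj
  proof (intro conjI ballI impI, rule gm, rule ccontr)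
    fix v assume v: "v \<in> carrier_vec p" "g *\<^sub>v v = 0\<^sub>v p" "v \<noteq> 0\<^sub>v p"
    have "g *\<^sub>v v = v + ?x *\<^sub>v v" unfolding g_def using v(1)
      by (subst add_mult_distrib_mat_vec[of _ p p]) auto
    then have s: "v + ?x *\<^sub>v v = 0\<^sub>v p" using v(2) by simp
    have xv: "?x *\<^sub>v v = (- 1) \<cdot>\<^sub>v v"
    proof (rule eq_vecI)
      fix r assume "r < dim_vec ((- 1) \<cdot>\<^sub>v v)"
      then have r: "r < p" using v(1) by simp
      have "(v + ?x *\<^sub>v v) $ r = 0" using s r by simp
      then have "v $ r + (?x *\<^sub>v v) $ r = 0" using r v(1) by simp
      then show "(?x *\<^sub>v v) $ r = ((- 1) \<cdot>\<^sub>v v) $ r" using r v(1) by (simp add: eq_neg_iff_add_eq_0 add.commute del: index_mult_mat_vec)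
    qed (use v in auto)
    have xi: "?x ^\<^sub>m i *\<^sub>v v = ((- 1) ^ i) \<cdot>\<^sub>v v" for i
    proof (induction i)
      case (Suc i)
      have "?x ^\<^sub>m Suc i *\<^sub>v v = ?x ^\<^sub>m i *\<^sub>v (?x *\<^sub>v v)"
        using v(1) by (simp add: assoc_mult_mat_vec[of _ p p _ p])
      also have "\<dots> = (- 1) \<cdot>\<^sub>v (?x ^\<^sub>m i *\<^sub>v v)" unfolding xv
        using v(1) by (intro mult_mat_vec[of _ p p]) auto
      also have "\<dots> = ((- 1) ^ Suc i) \<cdot>\<^sub>v v" unfolding Suc by (simp add: smult_smult_assoc)
      finally show ?case .
    qed (use v in simp)
    obtain r where r: "r < p" "v $ r \<noteq> 0" using v(1,3) by (metis eq_vecI carrier_vecD dim_vec index_zero_vec)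
    have "(cyc_mat p 0 b *\<^sub>v v) $ r = (\<Sum>c<p. cyc_mat p 0 b $$ (r, c) * v $ c)"
      using r v(1) by (auto simp: scalar_prod_def atLeast0LessThan)
    also have "\<dots> = (\<Sum>c<p. if c = r then b c * v $ c else 0)"
      by (rule sum.cong) (use r in \<open>auto simp: cyc_mat_index\<close>)
    also have "\<dots> = b r * v $ r" using r by (simp add: sum.delta)
    finally have "b 0 * v $ r = (- 1) ^ p * v $ r"
      using xi[of p] r v(1) const[OF r(1)] unfolding b by simp
    then have "(b 0 + 1) * v $ r = 0" using odd_p by (simp add: algebra_simps)
    then have "b 0 = - 1" using r(2) by (simp add: eq_neg_iff_add_eq_0)
    moreover have "b 0 ^ p = 1" using b1(1)[OF p_pos] .
    \<comment> \<open>From \<open>b 0 ^ p = 1\<close> with odd \<open>p\<close> follows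
      \<open>- 1 = 1\<close>, so \<open>b 0 = 1\<close>; this covers characteristic 2 as
      well.\<close>
    ultimately show False using a1 odd_p by simp
  qed
  have shift: "(c + k) mod p \<noteq> c" if "c < p" for c
  proof
    assume "(c + k) mod p = c"
    then have "(k + c) mod p = (0 + c) mod p" using that by (simp add: add.commute)
    then show False using add_mod_inj[of k p 0 c] k p_pos by simp
  qed
  have g_ix: "g $$ (r, c) = (if r = c then 1 else if r = (c + k) mod p then d c else 0)" if "r < p" "c < p" for r c
    using that shift[OF that(2), symmetric] by (auto simp: g_def cyc_mat_index)
  show ?thesis
  proof (rule in_two_Sylows_commuting[OF x gG _ bump_in_P[of 0]])
    show "g * ?x = ?x * g" unfolding g_def
      by (simp add: add_mult_distrib_mat[of _ p p _ _ p] mult_add_distrib_mat[of _ p p _ p])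
    fix m assume "m \<in> P"
    then obtain l f where m: "m = cyc_mat p l f" "l < p" "\<And>c. c < p \<Longrightarrow> f c \<noteq> 0"
      using P_obtain by metis
    show "g * bump 0 \<noteq> m * g"
    proof
      assume eq: "g * bump 0 = m * g"
      have ent: "g $$ ((s + l) mod p, c) * (if c = 0 then w else 1) = f s * g $$ (s, c)" if "s < p" "c < p" for s c
        using index_cyc_mat_mult[OF gm that, of l f] index_mult_cyc_mat[OF gm _ that(2), of "(s + l) mod p" 0 "\<lambda>c. if c = 0 then w else 1"]
          eq that p_pos unfolding m(1) bump_def by simp
      \<comment> \<open>Column 0 of \<open>g\<close> has support in rows 0 and \<open>k\<close>. The
        shift by \<open>l\<close> must preserve this pair, which for odd \<open>p\<close> leaves
        only \<open>l = 0\<close>; then columns 0 and \<open>k\<close> demand \<open>f k = w\<close>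
        and \<open>f k = 1\<close>.\<close>
      have e0: "g $$ (l, 0) * w = f 0" using ent[of 0 0] m(2) p_pos by (simp add: g_ix)
      have ek: "g $$ ((k + l) mod p, 0) * w = f k * d 0" using ent[of k 0] k p_pos by (simp add: g_ix)
      have "g $$ (l, 0) \<noteq> 0" using e0 m(3)[OF p_pos] by auto
      then have l1: "l = 0 \<or> l = k" using m(2) k p_pos by (auto simp: g_ix split: if_splits)
      have "g $$ ((k + l) mod p, 0) \<noteq> 0" using ek m(3)[OF k(2)] d[OF p_pos] by auto
      then have l2: "(k + l) mod p = 0 \<or> (k + l) mod p = k" using k p_pos by (auto simp: g_ix split: if_splits)
      have "l = 0"
      proof (rule ccontr)
        assume "l \<noteq> 0"
        then have "l = k" using l1 by simp
        moreover have "(k + k) mod p \<noteq> k" using shift[OF k(2)] .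
        ultimately have "p dvd 2 * k" using l2 by (auto simp: mult_2)
        then have "p dvd k" using odd_p prime_p by (simp add: coprime_dvd_mult_right_iff)
        then show False using k by (simp add: nat_dvd_not_less)
      qed
      then have "f k = w" using ek k p_pos d[OF p_pos] by (simp add: g_ix)
      moreover have "f k = 1" using ent[of k k] \<open>l = 0\<close> k by (simp add: g_ix)
      ultimately show False using w_neq_1 by simp
    qed
  qed
qed

lemma redundant_Sylow: "has_redundant_Sylow (GL p :: 'a mat monoid) p"
proof (rule group.has_redundant_SylowI[OF group_GL finite_GL prime_p wreath_group_Sylow])
  fix x assume x: "x \<in> P"
  have WP: "W p \<in> P" using w_power_root p_pos by (intro cyc_group_memI) auto
  \<comment> \<open>Diagonal matrices with distinct entries and shifted matrices with
    \<open>p\<close>-th power 1 both have all these eigenvalues, so both reduce to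
    \<open>W p\<close>.\<close>
  have conj_W: "in_two_Sylows (GL p) p x"
    if eig: "\<And>k. k < p \<Longrightarrow> \<exists>v\<in>carrier_vec p. v \<noteq> 0\<^sub>v p \<and> x *\<^sub>v v = w ^ k \<cdot>\<^sub>v v"
  proof -
    obtain g where "g \<in> carrier (GL p)" "x * g = g * W p"
      using diagonalizable_by_GL[OF GL_carrier_mat[OF P_carrier[OF x]] eig] by blast
    then show ?thesis
      using in_two_Sylows_transfer[OF P_carrier[OF x] P_carrier[OF WP]] in_two_Sylows_W by blast
  qed
  obtain k d where kd: "x = cyc_mat p k d" "k < p" "\<And>c. c < p \<Longrightarrow> d c ^ p = 1" "\<And>c. c < p \<Longrightarrow> d c \<noteq> 0"
    using P_obtain[OF x] by metis
  show "in_two_Sylows (GL p) p x"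
  proof (cases "k = 0")
    case True
    show ?thesis
    proof (cases "inj_on d {..<p}")
      case False
      then obtain i j where "i < p" "j < p" "i \<noteq> j" "d i = d j" by (auto simp: inj_on_def)
      then show ?thesis using in_two_Sylows_repeated x kd(1) True by blast
    next
      case inj: True
      \<comment> \<open>The \<open>p\<close> distinct entries exhaust the \<open>p\<close>-th roots
        of unity, and unit vectors then serve as eigenvectors.\<close>
      have "d ` {..<p} = {y. y ^ p = 1}"
        using kd(3) card_roots inj by (intro card_subset_eq) (auto simp: card_image)
      then have surj: "\<exists>c<p. d c = w ^ i" for i using w_power_root[of i] by (metis (mono_tags, lifting) image_iff lessThan_iff mem_Collect_eq)
      show ?thesis
      proof (rule conj_W)
        fix i assume "i < p"
        obtain c where c: "c < p" "d c = w ^ i" using surj by blast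
        have "x *\<^sub>v unit_vec p c = w ^ i \<cdot>\<^sub>v unit_vec p c"
          unfolding kd(1) True using c by (intro eq_vecI) (auto simp: cyc_mat_index)
        then show "\<exists>v\<in>carrier_vec p. v \<noteq> 0\<^sub>v p \<and> x *\<^sub>v v = w ^ i \<cdot>\<^sub>v v"
          using c(1) by (intro bexI[of _ "unit_vec p c"]) auto
      qed
    qed
  next
    case False
    show ?thesis
    proof (cases "x ^\<^sub>m p = 1\<^sub>m p")
      case True
      then show ?thesis using cyc_mat_eigenvector[of k d] w_power_root kd(1,2) False
        by (intro conj_W) auto
    next
      case no: False
      then show ?thesis using in_two_Sylows_pow_neq_one[of k d] x kd False by simp
    qed
  qed
qed

end

theorem theorem5p1:
  fixes p q :: nat
  assumes "Factorial_Ring.prime p" and "odd p"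
    and "q = card (UNIV :: ('a::{finite,field}) set)"
    and "\<exists>r k. Factorial_Ring.prime (r::nat) \<and> k > 0 \<and> q = r ^ k"
    and "p dvd q - 1" and "\<not> p ^ 2 dvd q - 1"
  shows "(\<forall>n. 1 < n \<and> n < p \<longrightarrow> \<not> has_redundant_Sylow (GL n :: 'a mat monoid) p)
         \<and> has_redundant_Sylow (GL p :: 'a mat monoid) p"
proof -
  obtain w :: 'a where "w ^ p = 1" "w \<noteq> 1"
    using ex_nontrivial_root_of_unity[where 'a = 'a] assms by blast
  then interpret GL_root_of_unity p w using assms by unfold_locales auto
  show ?thesis using no_redundant_Sylow redundant_Sylow by simp
qed

end
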